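(* There exist absolute constants $c,c'>0$ such that for every connected comparison graph $G$ on $n\ge 2$ nodes with Laplacian $L$, every integer $k\ge c\sqrt{\lambda_{\max}(L)}\,n\,\Omega_{\rm avg}$, and every estimator $\widehat W$ (any measurable function of the comparison outcomes taking values in $\mathbb{R}^n\setminus\{0\}$), $$\sup_{w\in\mathbb{R}^n_{+}}\mathbb{E}\left|\sin(\widehat W,w)\right|\ge c'\sqrt{\frac{\Omega_{\rm avg}}{k}},$$ where the supremum is over weight vectors $w$ with positive entries and the expectation is over the comparison outcomes generated with weights $w$.
   Context: Bradley–Terry–Luce model: $G=(V,E)$ is an undirected connected graph on $V=\{1,\dots,n\}$. For each edge $\{i,j\}\in E$, $k$ comparisons are performed between $i$ and $j$, each won by $i$ with probability $w_i/(w_i+w_j)$, all comparisons independent, where $w\in\mathbb{R}^n$ has positive entries. $L$ is the graph Laplacian of $G$, $\lambda_{\max}(L)$ its largest eigenvalue, and $L^\dagger$ its Moore–Penrose pseudoinverse. $\Omega_{ij}=(e_i-e_j)^TL^\dagger(e_i-e_j)$ is the effective resistance between $i$ and $j$ (unit resistor on each edge), and $\Omega_{\rm avg}$ is the average of $\Omega_{ij}$ over all unordered pairs $\{i,j\}$ with $i\neq j$. $\sin(x,y)$ is the sine of the angle between nonzero vectors $x,y$. *)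

theory Defs
  imports Complex_Main "Jordan_Normal_Form.Char_Poly"
begin

text \<open>Vertices are 0..<n (the paper's 1..n shifted). A simple undirected graph is a
symmetric irreflexive edge predicate on these vertices.\<close>

definition simple_graph :: "nat \<Rightarrow> (nat \<Rightarrow> nat \<Rightarrow> bool) \<Rightarrow> bool" where
  "simple_graph n E \<longleftrightarrow> (\<forall>i j. E i j \<longrightarrow> i < n \<and> j < n \<and> i \<noteq> j \<and> E j i)"

definition connected_graph :: "nat \<Rightarrow> (nat \<Rightarrow> nat \<Rightarrow> bool) \<Rightarrow> bool" where
  "connected_graph n E \<longleftrightarrow> (\<forall>i<n. \<forall>j<n. (i, j) \<in> {(a, b). E a b}\<^sup>*)"

definition laplacian :: "nat \<Rightarrow> (nat \<Rightarrow> nat \<Rightarrow> bool) \<Rightarrow> real mat" where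
  "laplacian n E = mat n n (\<lambda>(i, j).
      if i = j then real (card {l. l < n \<and> E i l}) else if E i j then -1 else 0)"

definition lambda_max :: "real mat \<Rightarrow> real" where
  "lambda_max A = Max {\<mu>. eigenvalue A \<mu>}"

text \<open>Moore--Penrose pseudoinverse: the unique matrix satisfying the four Penrose equations.\<close>
definition pinv :: "real mat \<Rightarrow> real mat" where
  "pinv A = (THE X. X \<in> carrier_mat (dim_col A) (dim_row A) \<and>
      A * X * A = A \<and> X * A * X = X \<and>
      transpose_mat (A * X) = A * X \<and> transpose_mat (X * A) = X * A)"

definition eff_res :: "nat \<Rightarrow> (nat \<Rightarrow> nat \<Rightarrow> bool) \<Rightarrow> nat \<Rightarrow> nat \<Rightarrow> real" where
  "eff_res n E i j = (let d = unit_vec n i - unit_vec n j in d \<bullet> (pinv (laplacian n E) *\<^sub>v d))"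

definition omega_avg :: "nat \<Rightarrow> (nat \<Rightarrow> nat \<Rightarrow> bool) \<Rightarrow> real" where
  "omega_avg n E = (\<Sum>(i, j) \<in> {(i, j). i < j \<and> j < n}. eff_res n E i j) / real (n choose 2)"

text \<open>Sine of the angle between two nonzero vectors.\<close>
definition vsin :: "real vec \<Rightarrow> real vec \<Rightarrow> real" where
  "vsin x y = sqrt (1 - (x \<bullet> y)\<^sup>2 / ((x \<bullet> x) * (y \<bullet> y)))"

text \<open>Comparison slots: (i, j, l) with i < j an edge and l < k the index of the comparison.
An outcome assigns to each slot True iff i wins; it is False outside the slots.\<close>
definition slots :: "nat \<Rightarrow> (nat \<Rightarrow> nat \<Rightarrow> bool) \<Rightarrow> nat \<Rightarrow> (nat \<times> nat \<times> nat) set" where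
  "slots n E k = {(i, j, l). i < j \<and> j < n \<and> E i j \<and> l < k}"

definition outcomes :: "nat \<Rightarrow> (nat \<Rightarrow> nat \<Rightarrow> bool) \<Rightarrow> nat \<Rightarrow> (nat \<times> nat \<times> nat \<Rightarrow> bool) set" where
  "outcomes n E k = {y. \<forall>s. s \<notin> slots n E k \<longrightarrow> \<not> y s}"

definition btl_prob :: "nat \<Rightarrow> (nat \<Rightarrow> nat \<Rightarrow> bool) \<Rightarrow> nat \<Rightarrow> real vec \<Rightarrow> (nat \<times> nat \<times> nat \<Rightarrow> bool) \<Rightarrow> real" where
  "btl_prob n E k w y = (\<Prod>(i, j, l) \<in> slots n E k.
      if y (i, j, l) then w $ i / (w $ i + w $ j) else w $ j / (w $ i + w $ j))"

text \<open>Expectation of f over the (finite) outcome space under BTL weights w.\<close>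
definition btl_expect :: "nat \<Rightarrow> (nat \<Rightarrow> nat \<Rightarrow> bool) \<Rightarrow> nat \<Rightarrow> real vec \<Rightarrow> ((nat \<times> nat \<times> nat \<Rightarrow> bool) \<Rightarrow> real) \<Rightarrow> real" where
  "btl_expect n E k w f = (\<Sum>y \<in> outcomes n E k. btl_prob n E k w y * f y)"

definition pos_weights :: "nat \<Rightarrow> real vec set" where
  "pos_weights n = {w. dim_vec w = n \<and> (\<forall>i<n. w $ i > 0)}"

end

theory Submission
  imports Defs "Jordan_Normal_Form.Spectral_Radius"
    "HOL-Analysis.Function_Topology" "HOL-Analysis.Convex" "HOL-Analysis.L2_Norm"
begin

text \<open>
Let \<open>v\<^sub>r\<close> be an orthonormal eigenbasis of \<open>L\<close> with eigenvalues \<open>\<mu>\<^sub>r\<close>. Assouad's method is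
applied to the weights \<open>exp \<theta>\<^sub>S\<close>, where \<open>\<theta>\<^sub>S = \<Sum>\<^sub>r \<plusminus>v\<^sub>r / sqrt (k \<mu>\<^sub>r)\<close> over the nonzero
eigenvalues and the signs are given by \<open>S\<close>. Flipping one sign changes \<open>\<theta>\<^sub>S\<close> by a vector of
Laplacian energy \<open>4 / k\<close>, and the Hellinger affinity of two outcome laws is at least
\<open>exp (- k * energy / 32)\<close>, so neighbouring hypotheses overlap by a constant. Moreover
\<open>\<Sum>\<^sub>r 1 / \<mu>\<^sub>r\<close> is \<open>(n - 1) / 2\<close> times the average resistance, and since the largest eigenvalue is
at least 1 the bound on \<open>k\<close> gives \<open>\<parallel>\<theta>\<^sub>S\<parallel> \<le> 1\<close>; in this range the sine between \<open>exp \<theta>\<^sub>S\<close> and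
\<open>exp \<theta>\<^sub>T\<close> is at least a constant times \<open>\<parallel>\<theta>\<^sub>S - \<theta>\<^sub>T\<parallel> / sqrt n\<close>, whose square is an additive
loss in the signs.
\<close>

section \<open>Spectral theorem for real symmetric matrices\<close>

text \<open>Vectors are functions on the naturals of which only the first \<open>n\<close> values
  count. This avoids carrier conditions and lets compactness come from the product topology.\<close>

definition ip :: "nat \<Rightarrow> (nat \<Rightarrow> real) \<Rightarrow> (nat \<Rightarrow> real) \<Rightarrow> real" where
  "ip n x y = (\<Sum>i<n. x i * y i)"

definition mv :: "nat \<Rightarrow> (nat \<Rightarrow> nat \<Rightarrow> real) \<Rightarrow> (nat \<Rightarrow> real) \<Rightarrow> nat \<Rightarrow> real" where
  "mv n A x i = (\<Sum>j<n. A i j * x j)"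

lemma ip_commute: "ip n x y = ip n y x"
  by (simp add: ip_def mult.commute)

lemma ip_add_left: "ip n (\<lambda>i. x i + y i) z = ip n x z + ip n y z"
  by (simp add: ip_def ring_distribs sum.distrib)

lemma ip_diff_left: "ip n (\<lambda>i. x i - y i) z = ip n x z - ip n y z"
  by (simp add: ip_def left_diff_distrib sum_subtractf)

lemma ip_scale_left: "ip n (\<lambda>i. c * x i) z = c * ip n x z"
  by (simp add: ip_def sum_distrib_left mult.assoc)

lemma ip_add_right: "ip n z (\<lambda>i. x i + y i) = ip n z x + ip n z y"
  using ip_add_left by (simp add: ip_commute)

lemma ip_diff_right: "ip n z (\<lambda>i. x i - y i) = ip n z x - ip n z y"
  using ip_diff_left by (simp add: ip_commute)

lemma ip_scale_right: "ip n z (\<lambda>i. c * x i) = c * ip n z x"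
  using ip_scale_left by (simp add: ip_commute)

lemma ip_sum_left: "ip n (\<lambda>i. \<Sum>r\<in>R. f r i) y = (\<Sum>r\<in>R. ip n (f r) y)"
  by (simp add: ip_def sum_distrib_right sum.swap[of _ R])

lemma ip_sum_right: "ip n y (\<lambda>i. \<Sum>r\<in>R. f r i) = (\<Sum>r\<in>R. ip n y (f r))"
  using ip_sum_left by (simp add: ip_commute)

lemmas ip_linear = ip_add_left ip_diff_left ip_scale_left ip_add_right ip_diff_right ip_scale_right

lemma ip_cong: "(\<And>i. i < n \<Longrightarrow> x i = x' i) \<Longrightarrow> (\<And>i. i < n \<Longrightarrow> y i = y' i) \<Longrightarrow> ip n x y = ip n x' y'"
  by (simp add: ip_def)

lemma ip_self: "ip n x x = (\<Sum>i<n. (x i)\<^sup>2)"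
  by (simp add: ip_def power2_eq_square)

lemma ip_self_nonneg: "0 \<le> ip n x x"
  by (simp add: ip_self sum_nonneg)

lemma ip_self_eq_0: "ip n x x = 0 \<longleftrightarrow> (\<forall>i<n. x i = 0)"
  by (auto simp: ip_self sum_nonneg_eq_0_iff)

lemma ip_Cauchy_Schwarz: "(ip n x y)\<^sup>2 \<le> ip n x x * ip n y y"
  unfolding ip_self unfolding ip_def by (rule Cauchy_Schwarz_ineq_sum)

lemma mv_add_scale: "mv n A (\<lambda>i. x i + c * y i) = (\<lambda>i. mv n A x i + c * mv n A y i)"
  by (rule ext) (simp add: mv_def ring_distribs sum.distrib sum_distrib_left mult_ac)

lemma mv_scale: "mv n A (\<lambda>i. c * y i) = (\<lambda>i. c * mv n A y i)"
  by (rule ext) (simp add: mv_def sum_distrib_left mult_ac)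

lemma ip_mv_symmetric:
  assumes "\<And>i j. i < n \<Longrightarrow> j < n \<Longrightarrow> A i j = A j i"
  shows "ip n x (mv n A y) = ip n (mv n A x) y"
proof -
  have "ip n x (mv n A y) = (\<Sum>i<n. \<Sum>j<n. x i * A i j * y j)"
    by (simp add: ip_def mv_def sum_distrib_left mult_ac)
  also have "\<dots> = (\<Sum>j<n. \<Sum>i<n. x i * A i j * y j)" by (rule sum.swap)
  also have "\<dots> = (\<Sum>j<n. \<Sum>i<n. A j i * x i * y j)"
    by (intro sum.cong refl) (use assms in \<open>simp add: mult_ac\<close>)
  also have "\<dots> = ip n (mv n A x) y"
    by (simp add: ip_def mv_def sum_distrib_right)
  finally show ?thesis .
qed

text \<open>Padding the \<open>k\<close> vectors with zero rows gives a square matrix that is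
  singular because \<open>k < n\<close>; a normalised kernel vector is orthogonal to all of them.
  Its values beyond the first \<open>n\<close> coordinates are set to zero so that it lies in a
  compact set.\<close>

lemma exists_unit_orthogonal:
  fixes v :: "nat \<Rightarrow> nat \<Rightarrow> real"
  assumes "k < n"
  shows "\<exists>x. (\<forall>i\<ge>n. x i = 0) \<and> ip n x x = 1 \<and> (\<forall>r<k. ip n (v r) x = 0)"
proof -
  define A where "A = mat n n (\<lambda>(r, i). if r < k then v r i else 0)"
  have A: "A \<in> carrier_mat n n" by (simp add: A_def)
  have "A = mat\<^sub>r n n (\<lambda>r. if r = k then 0\<^sub>v n else row A r)"
    using assms by (intro eq_matI) (auto simp: A_def)
  moreover have "det (mat\<^sub>r n n (\<lambda>r. if r = k then 0\<^sub>v n else row A r)) = 0"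
    by (rule det_row_0[OF assms]) (auto simp: A_def)
  ultimately have "det A = 0" by simp
  then obtain u where u: "u \<in> carrier_vec n" "u \<noteq> 0\<^sub>v n" "A *\<^sub>v u = 0\<^sub>v n"
    using det_0_iff_vec_prod_zero_field[OF A] by blast
  define y where "y i = (if i < n then u $ i else 0)" for i
  have orth: "ip n (v r) y = 0" if "r < k" for r
  proof -
    have "(A *\<^sub>v u) $ r = ip n (v r) y"
      using that assms u(1)
      by (auto simp: A_def ip_def y_def scalar_prod_def lessThan_atLeast0 intro!: sum.cong)
    then show ?thesis using u(3) that assms by simp
  qed
  have "ip n y y \<noteq> 0"
  proof
    assume "ip n y y = 0"
    then have "u = 0\<^sub>v n" using u(1) by (intro eq_vecI) (auto simp: ip_self_eq_0 y_def)
    with u(2) show False by simp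
  qed
  then have pos: "ip n y y > 0" using ip_self_nonneg[of n y] by simp
  define c where "c = 1 / sqrt (ip n y y)"
  have c: "c * c * ip n y y = 1" using pos by (simp add: c_def)
  define x where "x i = c * y i" for i
  have "ip n x x = 1"
    using c by (simp add: x_def[abs_def] ip_linear mult.assoc)
  moreover have "ip n (v r) x = 0" if "r < k" for r
    using orth[OF that] by (simp add: x_def[abs_def] ip_linear)
  moreover have "\<forall>i\<ge>n. x i = 0" by (simp add: x_def y_def)
  ultimately show ?thesis by blast
qed

text \<open>The unit norm confines the first \<open>n\<close> coordinates to the interval from -1 to
  1 and the others are pinned to 0, so the set is a closed subset of a product of compact sets
  (Tychonoff).\<close>

lemma compact_unit_sphere_orthogonal:
  "compact {x. (\<forall>i\<ge>n. x i = 0) \<and> ip n x x = 1 \<and> (\<forall>r<k. ip n (v r) x = 0)}" (is "compact ?K")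
proof -
  let ?B = "Pi\<^sub>E UNIV (\<lambda>i. if i < n then {-1..1::real} else {0})"
  have "compactin (product_topology (\<lambda>_::nat. euclidean) UNIV) ?B"
    by (auto simp: compactin_PiE)
  then have B: "compact ?B"
    by (metis compactin_euclidean_iff euclidean_product_topology)
  have cont: "continuous_on UNIV (\<lambda>x. ip n (f x) (g x))"
    if "\<And>i. continuous_on UNIV (\<lambda>x. f x i)" "\<And>i. continuous_on UNIV (\<lambda>x. g x i)"
    for f g :: "(nat \<Rightarrow> real) \<Rightarrow> nat \<Rightarrow> real"
    unfolding ip_def by (intro continuous_intros that)
  have "closed {x. (\<forall>i\<ge>n. x i = (0::real)) \<and> ip n x x = 1 \<and> (\<forall>r<k. ip n (v r) x = 0)}"
    by (intro closed_Collect_conj closed_Collect_all closed_Collect_imp closed_Collect_eq open_Collect_const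
        cont continuous_intros continuous_on_product_coordinates)
  moreover have "?K \<subseteq> ?B"
  proof
    fix x assume "x \<in> ?K"
    then have x: "\<And>i. i \<ge> n \<Longrightarrow> x i = 0" "ip n x x = 1" by auto
    have "\<bar>x i\<bar> \<le> 1" if "i < n" for i
    proof -
      have "(x i)\<^sup>2 \<le> ip n x x" unfolding ip_self using that by (intro member_le_sum) auto
      then show ?thesis using x(2) by (simp add: abs_square_le_1)
    qed
    with x(1) show "x \<in> ?B" by (auto simp: abs_le_iff minus_le_iff)
  qed
  ultimately show ?thesis
    using B by (metis (no_types, lifting) closed_Int_compact inf.absorb1)
qed

text \<open>First-order condition at a maximum: for small \<open>t\<close> a nonzero linear term
  would beat the quadratic one. The test point is \<open>t = s / d\<close> with \<open>d\<close>
  positive and above \<open>c\<close>.\<close>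

lemma linear_le_quadratic_imp_zero:
  fixes s c :: real
  assumes "\<And>t. 2 * t * s \<le> t\<^sup>2 * c"
  shows "s = 0"
proof (rule ccontr)
  assume s: "s \<noteq> 0"
  define d where "d = \<bar>c\<bar> + 1"
  have d: "d > 0" "c < d" by (auto simp: d_def)
  have "2 * (s / d) * s \<le> (s / d)\<^sup>2 * c" by (rule assms)
  then have "2 * s\<^sup>2 * d \<le> s\<^sup>2 * c"
    using d by (simp add: field_simps power2_eq_square)
  then have "s\<^sup>2 * (2 * d) \<le> s\<^sup>2 * c" by (simp add: mult_ac)
  then have "2 * d \<le> c" using s by simp
  with d show False by simp
qed

text \<open>The maximiser of the Rayleigh quotient on the orthogonal complement of the eigenvectors found
so far is the next eigenvector.\<close>
lemma exists_next_eigenvector: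
  assumes sym: "\<And>i j. i < n \<Longrightarrow> j < n \<Longrightarrow> A i j = A j i"
    and k: "k < n"
    and eig: "\<And>r i. r < k \<Longrightarrow> i < n \<Longrightarrow> mv n A (v r) i = \<mu> r * v r i"
  shows "\<exists>x l. ip n x x = 1 \<and> (\<forall>r<k. ip n (v r) x = 0) \<and> (\<forall>i<n. mv n A x i = l * x i)"
proof -
  define K where "K = {x. (\<forall>i\<ge>n. x i = 0) \<and> ip n x x = 1 \<and> (\<forall>r<k. ip n (v r) x = 0)}"
  have "compact K" unfolding K_def by (rule compact_unit_sphere_orthogonal)
  moreover have "K \<noteq> {}" using exists_unit_orthogonal[OF k, of v] by (auto simp: K_def)
  moreover have "continuous_on K (\<lambda>x. ip n x (mv n A x))"
    unfolding ip_def mv_def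
    by (rule continuous_on_subset[OF _ subset_UNIV]) (intro continuous_intros continuous_on_product_coordinates)
  ultimately obtain x where x: "x \<in> K" and max: "\<And>y. y \<in> K \<Longrightarrow> ip n y (mv n A y) \<le> ip n x (mv n A x)"
    using continuous_attains_sup[of K "\<lambda>x. ip n x (mv n A x)"] by blast
  define l where "l = ip n x (mv n A x)"
  have x0: "\<And>i. i \<ge> n \<Longrightarrow> x i = 0" and x1: "ip n x x = 1" and xv: "\<And>r. r < k \<Longrightarrow> ip n (v r) x = 0"
    using x by (auto simp: K_def)
  \<comment> \<open>Homogeneity carries the maximality of \<open>l\<close> from the unit vectors in
    \<open>K\<close> to the whole orthogonal complement.\<close>
  have rayleigh: "ip n y (mv n A y) \<le> l * ip n y y"
    if y0: "\<And>i. i \<ge> n \<Longrightarrow> y i = 0" and yv: "\<And>r. r < k \<Longrightarrow> ip n (v r) y = 0" for y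
  proof (cases "ip n y y = 0")
    case True
    then have "ip n y (mv n A y) = 0" unfolding ip_self_eq_0 by (simp add: ip_def)
    with True show ?thesis by simp
  next
    case False
    then have pos: "ip n y y > 0" using ip_self_nonneg[of n y] by simp
    define c where "c = 1 / sqrt (ip n y y)"
    have c: "c * c * ip n y y = 1" using pos by (simp add: c_def)
    have "(\<lambda>i. c * y i) \<in> K"
      using c by (auto simp: K_def y0 yv ip_linear mult.assoc)
    from max[OF this] have "c * c * ip n y (mv n A y) \<le> l"
      by (simp add: mv_scale ip_linear l_def mult.assoc)
    then have "(c * c * ip n y y) * ip n y (mv n A y) \<le> l * ip n y y"
      using pos by (metis mult.commute mult.left_commute mult_le_cancel_right_pos)
    with c show ?thesis by simp
  qed
  \<comment> \<open>The residual of the eigenvalue equation is orthogonal to \<open>x\<close> and to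
    the earlier eigenvectors, hence an admissible direction of perturbation.\<close>
  define u where "u i = (if i < n then mv n A x i - l * x i else 0)" for i
  have u0: "u i = 0" if "i \<ge> n" for i using that by (simp add: u_def)
  have ipu: "ip n y u = ip n y (mv n A x) - l * ip n y x" for y
    by (simp add: u_def ip_def right_diff_distrib sum_subtractf sum_distrib_left mult_ac)
  have ux: "ip n x u = 0" by (simp add: ipu x1 l_def)
  have uv: "ip n (v r) u = 0" if "r < k" for r
  proof -
    have "ip n (v r) (mv n A x) = ip n (\<lambda>i. \<mu> r * v r i) x"
      proof -
      have "ip n (v r) (mv n A x) = ip n (mv n A (v r)) x" by (rule ip_mv_symmetric[OF sym])
      also have "\<dots> = ip n (\<lambda>i. \<mu> r * v r i) x" by (rule ip_cong) (simp_all add: eig that)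
      finally show ?thesis .
    qed
    then show ?thesis using xv[OF that] by (simp add: ipu ip_linear)
  qed
  have uu: "ip n u (mv n A x) = ip n u u"
    using ipu[of u] ux by (simp add: ip_commute)
  \<comment> \<open>This is the Rayleigh bound at \<open>x + t * u\<close>. The linear term in
    \<open>t\<close> is a multiple of \<open>ip n u u\<close>, so the residual must vanish.\<close>
  have "2 * t * ip n u u \<le> t\<^sup>2 * (l * ip n u u - ip n u (mv n A u))" for t
  proof -
    have "ip n (\<lambda>i. x i + t * u i) (mv n A (\<lambda>i. x i + t * u i))
        \<le> l * ip n (\<lambda>i. x i + t * u i) (\<lambda>i. x i + t * u i)"
      by (rule rayleigh) (simp_all add: x0 u0 ip_linear xv uv)
    moreover have "ip n (\<lambda>i. x i + t * u i) (mv n A (\<lambda>i. x i + t * u i))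
        = l + 2 * t * ip n u u + t\<^sup>2 * ip n u (mv n A u)"
    proof -
      have "ip n x (mv n A u) = ip n u u"
        using uu ip_mv_symmetric[where A = A and n = n and x = x and y = u, OF sym] by (simp add: ip_commute)
      then show ?thesis
        by (simp add: mv_add_scale ip_linear uu l_def power2_eq_square algebra_simps)
    qed
    moreover have "ip n (\<lambda>i. x i + t * u i) (\<lambda>i. x i + t * u i) = 1 + t\<^sup>2 * ip n u u"
      using ux by (simp add: ip_linear x1 ip_commute power2_eq_square)
    ultimately show ?thesis by (simp add: algebra_simps)
  qed
  then have "ip n u u = 0" by (rule linear_le_quadratic_imp_zero)
  then have "mv n A x i = l * x i" if "i < n" for i
    using that by (simp add: ip_self_eq_0 u_def)
  with x1 xv show ?thesis by blast
qed

lemma symmetric_orthonormal_eigenbasis: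
  assumes sym: "\<And>i j. i < n \<Longrightarrow> j < n \<Longrightarrow> A i j = A j i"
  obtains v \<mu> where
    "\<And>r s. r < n \<Longrightarrow> s < n \<Longrightarrow> ip n (v r) (v s) = of_bool (r = s)"
    "\<And>i j. i < n \<Longrightarrow> j < n \<Longrightarrow> (\<Sum>r<n. v r i * v r j) = of_bool (i = j)"
    "\<And>r i. r < n \<Longrightarrow> i < n \<Longrightarrow> mv n A (v r) i = \<mu> r * v r i"
proof -
  have "\<exists>v \<mu>. (\<forall>r<k. \<forall>s<k. ip n (v r) (v s) = of_bool (r = s)) \<and>
           (\<forall>r<k. \<forall>i<n. mv n A (v r) i = \<mu> r * v r i)" if "k \<le> n" for k
    using that
  proof (induction k)
    case 0
    show ?case by simp
  next
    case (Suc k)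
    then have "k \<le> n" by simp
    from Suc.IH[OF this] obtain v \<mu> where v: "\<forall>r<k. \<forall>s<k. ip n (v r) (v s) = of_bool (r = s)"
      "\<And>r i. r < k \<Longrightarrow> i < n \<Longrightarrow> mv n A (v r) i = \<mu> r * v r i" by blast
    have "\<exists>x l. ip n x x = 1 \<and> (\<forall>r<k. ip n (v r) x = 0) \<and> (\<forall>i<n. mv n A x i = l * x i)"
      by (rule exists_next_eigenvector[where \<mu> = \<mu>]) (erule (1) sym, use Suc.prems in linarith, erule (1) v(2))
    then obtain x l where x: "ip n x x = 1" "\<forall>r<k. ip n (v r) x = 0" "\<forall>i<n. mv n A x i = l * x i"
      by (elim exE conjE) (rule that)
    define w where "w = v(k := x)"
    define l' where "l' = \<mu>(k := l)"
    have "ip n (w r) (w s) = of_bool (r = s)" if "r < Suc k" "s < Suc k" for r s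
      using v(1) x(1,2) that ip_commute[of n x "v s"]
      by (cases "r = k"; cases "s = k") (simp_all add: w_def)
    moreover have "mv n A (w r) i = l' r * w r i" if "r < Suc k" "i < n" for r i
      using v(2) x(3) that by (cases "r = k") (simp_all add: w_def l'_def)
    ultimately show ?case by (intro exI[of _ w] exI[of _ l']) simp
  qed
  from this[of n] obtain v \<mu> where
    v: "\<And>r s. r < n \<Longrightarrow> s < n \<Longrightarrow> ip n (v r) (v s) = of_bool (r = s)" and
    eig: "\<And>r i. r < n \<Longrightarrow> i < n \<Longrightarrow> mv n A (v r) i = \<mu> r * v r i" by blast
  \<comment> \<open>For a square matrix a one-sided inverse is two-sided: orthonormality of the rows
    of \<open>V\<close> becomes orthonormality of its columns, which is the completeness
    relation.\<close>
  define V where "V = mat n n (\<lambda>(r, i). v r i)"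
  have V: "V \<in> carrier_mat n n" by (simp add: V_def)
  have "V * transpose_mat V = 1\<^sub>m n"
    by (intro eq_matI) (auto simp: V_def scalar_prod_def v[unfolded ip_def] simp flip: lessThan_atLeast0)
  then have *: "transpose_mat V * V = 1\<^sub>m n"
    using mat_mult_left_right_inverse[OF V, of "transpose_mat V"] V by auto
  have "(\<Sum>r<n. v r i * v r j) = of_bool (i = j)" if "i < n" "j < n" for i j
  proof -
    have "(transpose_mat V * V) $$ (i, j) = (\<Sum>r<n. v r i * v r j)"
      using that by (auto simp: V_def scalar_prod_def lessThan_atLeast0)
    with * that show ?thesis by (auto split: if_splits)
  qed
  with v eig that show ?thesis by blast
qed

section \<open>Spectrum of the Laplacian and effective resistance\<close>

lemma sum_symmetric_eq_twice:
  fixes f :: "nat \<Rightarrow> nat \<Rightarrow> real"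
  assumes sym: "\<And>i j. i < n \<Longrightarrow> j < n \<Longrightarrow> f i j = f j i" and diag: "\<And>i. i < n \<Longrightarrow> f i i = 0"
  shows "(\<Sum>i<n. \<Sum>j<n. f i j) = 2 * (\<Sum>(i, j) \<in> {(i, j). i < j \<and> j < n}. f i j)"
proof -
  let ?U = "{(i, j). i < j \<and> j < n}" and ?D = "{(i, j). i = j \<and> j < n}" and ?T = "{(i, j). j < i \<and> i < n}"
  have fin: "finite ?U" "finite ?D" "finite ?T"
    by (rule finite_subset[of _ "{..<n} \<times> {..<n}"]; auto)+
  have "(\<Sum>i<n. \<Sum>j<n. f i j) = (\<Sum>(i, j) \<in> {..<n} \<times> {..<n}. f i j)"
    by (rule sum.cartesian_product)
  also have "{..<n} \<times> {..<n} = ?U \<union> ?D \<union> ?T" by auto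
  also have "(\<Sum>(i, j) \<in> ?U \<union> ?D \<union> ?T. f i j)
      = (\<Sum>(i, j) \<in> ?U. f i j) + (\<Sum>(i, j) \<in> ?D. f i j) + (\<Sum>(i, j) \<in> ?T. f i j)"
  proof -
    have "(?U \<union> ?D) \<inter> ?T = {}" "?U \<inter> ?D = {}" by auto
    then show ?thesis using fin by (simp add: sum.union_disjoint)
  qed
  also have "(\<Sum>(i, j) \<in> ?D. f i j) = 0" by (rule sum.neutral) (auto simp: diag)
  also have "(\<Sum>(i, j) \<in> ?T. f i j) = (\<Sum>(i, j) \<in> ?U. f i j)"
    by (rule sum.reindex_bij_witness[of _ prod.swap prod.swap]) (auto simp: sym)
  finally show ?thesis by simp
qed

abbreviation lap :: "nat \<Rightarrow> (nat \<Rightarrow> nat \<Rightarrow> bool) \<Rightarrow> nat \<Rightarrow> nat \<Rightarrow> real" where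
  "lap n E \<equiv> \<lambda>i j. laplacian n E $$ (i, j)"

context
  fixes n :: nat and E :: "nat \<Rightarrow> nat \<Rightarrow> bool"
  assumes graph: "simple_graph n E"
begin

lemma edge_sym: "E i j \<longleftrightarrow> E j i" and edge_irrefl: "\<not> E i i"
  using graph by (auto simp: simple_graph_def)

lemma laplacian_carrier: "laplacian n E \<in> carrier_mat n n"
  by (simp add: laplacian_def)

lemma lap_sym: "i < n \<Longrightarrow> j < n \<Longrightarrow> lap n E i j = lap n E j i"
  using edge_sym by (auto simp: laplacian_def)

lemma lap_eq:
  assumes "i < n" "j < n"
  shows "lap n E i j = of_bool (i = j) * (\<Sum>l<n. of_bool (E i l)) - of_bool (E i j)"
proof -
  have "{l. l < n \<and> E i l} = {..<n} \<inter> {l. E i l}" by auto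
  then show ?thesis using assms edge_irrefl by (auto simp: laplacian_def)
qed

lemma mv_lap:
  assumes "i < n"
  shows "mv n (lap n E) x i = (\<Sum>j<n. of_bool (E i j) * (x i - x j))"
proof -
  have "mv n (lap n E) x i
      = (\<Sum>j<n. of_bool (i = j) * (\<Sum>l<n. of_bool (E i l)) * x j - of_bool (E i j) * x j)"
    unfolding mv_def using assms by (intro sum.cong refl) (simp add: lap_eq left_diff_distrib)
  also have "\<dots> = (\<Sum>l<n. of_bool (E i l)) * x i - (\<Sum>j<n. of_bool (E i j) * x j)"
    using assms by (simp add: sum_subtractf of_bool_def if_distrib[of "\<lambda>t. t * _"] cong: if_cong)
  also have "\<dots> = (\<Sum>j<n. of_bool (E i j) * (x i - x j))"
    by (simp add: sum_distrib_right sum_subtractf right_diff_distrib)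
  finally show ?thesis .
qed

text \<open>Symmetry moves the Laplacian onto the constant vector, which it annihilates.
  Eigenvectors for nonzero eigenvalues are therefore centred.\<close>

lemma sum_mv_lap: "(\<Sum>i<n. mv n (lap n E) x i) = 0"
proof -
  have "ip n (\<lambda>_. 1) (mv n (lap n E) x) = ip n (mv n (lap n E) (\<lambda>_. 1)) x"
    by (rule ip_mv_symmetric) (rule lap_sym)
  also have "\<dots> = 0" by (simp add: ip_def mv_lap)
  finally show ?thesis by (simp add: ip_def)
qed

text \<open>Adding the double sum to its copy with \<open>i\<close> and \<open>j\<close> exchanged
  completes the square. This form gives nonnegativity of the spectrum and matches the exponent in
  \<open>btl_affinity\<close>.\<close>

lemma laplacian_energy:
  "ip n x (mv n (lap n E) x) = (\<Sum>(i, j) \<in> {(i, j). i < j \<and> j < n}. of_bool (E i j) * (x i - x j)\<^sup>2)"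
proof -
  define f where "f i j = (of_bool (E i j) :: real)" for i j
  have fsym: "f i j = f j i" for i j using edge_sym by (simp add: f_def)
  have 1: "ip n x (mv n (lap n E) x) = (\<Sum>i<n. \<Sum>j<n. f i j * (x i * (x i - x j)))"
    unfolding ip_def by (intro sum.cong refl) (simp add: mv_lap sum_distrib_left f_def mult_ac del: sum_of_bool_mult_eq sum_mult_of_bool_eq)
  also have "\<dots> = (\<Sum>i<n. \<Sum>j<n. f i j * (x j * (x j - x i)))"
    by (subst sum.swap) (simp add: fsym)
  finally have "2 * ip n x (mv n (lap n E) x)
      = (\<Sum>i<n. \<Sum>j<n. f i j * (x i * (x i - x j)) + f i j * (x j * (x j - x i)))"
    using 1 by (simp add: sum.distrib)
  also have "\<dots> = (\<Sum>i<n. \<Sum>j<n. f i j * (x i - x j)\<^sup>2)"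
    by (intro sum.cong refl) (simp add: power2_eq_square algebra_simps)
  also have "\<dots> = 2 * (\<Sum>(i, j) \<in> {(i, j). i < j \<and> j < n}. f i j * (x i - x j)\<^sup>2)"
    by (rule sum_symmetric_eq_twice) (auto simp: fsym power2_commute)
  finally show ?thesis by (simp add: f_def)
qed

end

section \<open>The Moore-Penrose pseudoinverse in spectral coordinates\<close>

lemma penrose_unique:
  fixes A X Y :: "real mat"
  assumes A: "A \<in> carrier_mat n m" and X: "X \<in> carrier_mat m n" and Y: "Y \<in> carrier_mat m n"
    and X1: "A * X * A = A" and X2: "X * A * X = X"
    and X3: "transpose_mat (A * X) = A * X" and X4: "transpose_mat (X * A) = X * A"
    and Y1: "A * Y * A = A" and Y2: "Y * A * Y = Y"
    and Y3: "transpose_mat (A * Y) = A * Y" and Y4: "transpose_mat (Y * A) = Y * A"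
  shows "X = Y"
proof -
  have AX: "A * X \<in> carrier_mat n n" and AY: "A * Y \<in> carrier_mat n n"
    and XA: "X * A \<in> carrier_mat m m" and YA: "Y * A \<in> carrier_mat m m" using A X Y by auto
  \<comment> \<open>\<open>A * X\<close> and \<open>A * Y\<close> are symmetric and each absorbs the
    other, so transposing their product exchanges the factors and identifies the two;
    \<open>X * A\<close> and \<open>Y * A\<close> are treated alike.\<close>
  have "A * X = (A * Y) * (A * X)"
    using Y1 assoc_mult_mat[OF AY A X] by simp
  then have "A * X = transpose_mat ((A * Y) * (A * X))" using X3 by simp
  also have "\<dots> = (A * X) * (A * Y)" using transpose_mult[OF AY AX] X3 Y3 by simp
  also have "\<dots> = A * Y" using X1 assoc_mult_mat[OF AX A Y] by simp
  finally have AXY: "A * X = A * Y" .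
  have "Y * A = (Y * A) * (X * A)"
    using X1 assoc_mult_mat[OF YA X A] assoc_mult_mat[OF Y A X] assoc_mult_mat[OF Y AX A] by simp
  then have "Y * A = transpose_mat ((Y * A) * (X * A))" using Y4 by simp
  also have "\<dots> = (X * A) * (Y * A)" using transpose_mult[OF YA XA] X4 Y4 by simp
  also have "\<dots> = X * A"
    using Y1 assoc_mult_mat[OF XA Y A] assoc_mult_mat[OF X A Y] assoc_mult_mat[OF X AY A] by simp
  finally have XYA: "Y * A = X * A" .
  have "X = X * A * X" using X2 by simp
  also have "\<dots> = Y * A * X" using XYA by simp
  also have "\<dots> = Y * (A * X)" by (rule assoc_mult_mat[OF Y A X])
  also have "\<dots> = Y * A * Y" using AXY assoc_mult_mat[OF Y A Y] by simp
  finally show ?thesis using Y2 by simp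
qed

lemma pinv_eqI:
  assumes "A \<in> carrier_mat n m" "X \<in> carrier_mat m n"
    and "A * X * A = A" "X * A * X = X"
    and "transpose_mat (A * X) = A * X" "transpose_mat (X * A) = X * A"
  shows "pinv A = X"
  unfolding pinv_def
proof (rule the_equality)
  show "X \<in> carrier_mat (dim_col A) (dim_row A) \<and> A * X * A = A \<and> X * A * X = X \<and>
      transpose_mat (A * X) = A * X \<and> transpose_mat (X * A) = X * A"
    using assms by auto
next
  fix Y
  assume Y: "Y \<in> carrier_mat (dim_col A) (dim_row A) \<and> A * Y * A = A \<and> Y * A * Y = Y \<and>
      transpose_mat (A * Y) = A * Y \<and> transpose_mat (Y * A) = Y * A"
  then have "Y \<in> carrier_mat m n" using assms(1) by auto
  then show "Y = X" using Y assms by (intro penrose_unique[of A n m Y X]) auto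
qed

text \<open>This is V diag(d) V^T with the \<open>v r\<close> as columns of V. For a fixed
  orthonormal basis, products and pseudoinverses become operations on \<open>d\<close>.\<close>

definition spectral_mat :: "nat \<Rightarrow> (nat \<Rightarrow> nat \<Rightarrow> real) \<Rightarrow> (nat \<Rightarrow> real) \<Rightarrow> real mat" where
  "spectral_mat n v d = mat n n (\<lambda>(i, j). \<Sum>r<n. d r * v r i * v r j)"

lemma spectral_mat_carrier: "spectral_mat n v d \<in> carrier_mat n n"
  by (simp add: spectral_mat_def)

lemma transpose_spectral_mat: "transpose_mat (spectral_mat n v d) = spectral_mat n v d"
  by (intro eq_matI) (auto simp: spectral_mat_def mult_ac)

lemma spectral_mat_mult:
  assumes orth: "\<And>r s. r < n \<Longrightarrow> s < n \<Longrightarrow> ip n (v r) (v s) = of_bool (r = s)"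
  shows "spectral_mat n v d * spectral_mat n v e = spectral_mat n v (\<lambda>r. d r * e r)"
proof (rule eq_matI)
  fix i j assume "i < dim_row (spectral_mat n v (\<lambda>r. d r * e r))" "j < dim_col (spectral_mat n v (\<lambda>r. d r * e r))"
  then have ij: "i < n" "j < n" by (auto simp: spectral_mat_def)
  have "(spectral_mat n v d * spectral_mat n v e) $$ (i, j)
      = (\<Sum>l<n. (\<Sum>r<n. d r * v r i * v r l) * (\<Sum>s<n. e s * v s l * v s j))"
    using ij by (auto simp: spectral_mat_def scalar_prod_def lessThan_atLeast0 intro!: sum.cong)
  also have "\<dots> = (\<Sum>l<n. \<Sum>r<n. \<Sum>s<n. d r * v r i * e s * v s j * (v r l * v s l))"
    by (simp add: sum_product mult_ac)
  also have "\<dots> = (\<Sum>r<n. \<Sum>l<n. \<Sum>s<n. d r * v r i * e s * v s j * (v r l * v s l))"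
    by (rule sum.swap)
  also have "\<dots> = (\<Sum>r<n. \<Sum>s<n. \<Sum>l<n. d r * v r i * e s * v s j * (v r l * v s l))"
    by (rule sum.cong[OF refl], rule sum.swap)
  also have "\<dots> = (\<Sum>r<n. \<Sum>s<n. d r * v r i * e s * v s j * of_bool (r = s))"
    by (intro sum.cong refl) (simp add: orth[unfolded ip_def] flip: sum_distrib_left)
  also have "\<dots> = (\<Sum>r<n. d r * e r * v r i * v r j)"
    by (intro sum.cong refl) (simp add: of_bool_def if_distrib[of "\<lambda>t. _ * t"] mult_ac cong: if_cong)
  finally show "(spectral_mat n v d * spectral_mat n v e) $$ (i, j) = spectral_mat n v (\<lambda>r. d r * e r) $$ (i, j)"
    using ij by (simp add: spectral_mat_def)
qed (auto simp: spectral_mat_def)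

text \<open>The Penrose equations reduce to scalar identities in each \<open>d r\<close>, and the
  convention \<open>inverse 0 = 0\<close> makes them hold on the kernel as well.\<close>

lemma pinv_spectral_mat:
  assumes "\<And>r s. r < n \<Longrightarrow> s < n \<Longrightarrow> ip n (v r) (v s) = of_bool (r = s)"
  shows "pinv (spectral_mat n v d) = spectral_mat n v (\<lambda>r. inverse (d r))"
proof -
  have [simp]: "(\<lambda>r. d r * inverse (d r) * d r) = d" "(\<lambda>r. inverse (d r) * d r * inverse (d r)) = (\<lambda>r. inverse (d r))"
    by (rule ext, case_tac "d r = 0"; simp)+
  show ?thesis
    by (rule pinv_eqI[of _ n n])
      (simp_all add: spectral_mat_carrier transpose_spectral_mat spectral_mat_mult[where v = v and n = n, OF assms])
qed

text \<open>Effective resistance is expressed through the spectrum with \<open>inverse 0 = 0\<close> absorbing the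
kernel of the Laplacian.\<close>
lemma laplacian_spectrum:
  assumes graph: "simple_graph n E" and n: "n \<ge> 2"
  obtains v \<mu> where
    "\<And>r s. r < n \<Longrightarrow> s < n \<Longrightarrow> ip n (v r) (v s) = of_bool (r = s)"
    "\<And>r i. r < n \<Longrightarrow> i < n \<Longrightarrow> mv n (lap n E) (v r) i = \<mu> r * v r i"
    "\<And>r. r < n \<Longrightarrow> \<mu> r \<ge> 0"
    "\<And>r. r < n \<Longrightarrow> \<mu> r \<noteq> 0 \<Longrightarrow> (\<Sum>i<n. v r i) = 0"
    "\<And>r. r < n \<Longrightarrow> \<mu> r \<le> lambda_max (laplacian n E)"
    "(\<Sum>r<n. \<mu> r) = (\<Sum>i<n. lap n E i i)"
    "omega_avg n E = 2 * (\<Sum>r<n. inverse (\<mu> r)) / (real n - 1)"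
proof -
  obtain v \<mu> where
    orth: "\<And>r s. r < n \<Longrightarrow> s < n \<Longrightarrow> ip n (v r) (v s) = of_bool (r = s)" and
    compl: "\<And>i j. i < n \<Longrightarrow> j < n \<Longrightarrow> (\<Sum>r<n. v r i * v r j) = of_bool (i = j)" and
    eig: "\<And>r i. r < n \<Longrightarrow> i < n \<Longrightarrow> mv n (lap n E) (v r) i = \<mu> r * v r i"
    by (rule symmetric_orthonormal_eigenbasis[of n "lap n E", OF lap_sym[OF graph]]) blast+
  \<comment> \<open>The eigenvalue equation together with completeness of the basis diagonalises the
    Laplacian, which makes its pseudoinverse explicit.\<close>
  have L: "laplacian n E = spectral_mat n v \<mu>"
  proof (rule eq_matI)
    fix i j assume "i < dim_row (spectral_mat n v \<mu>)" "j < dim_col (spectral_mat n v \<mu>)"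
    then have ij: "i < n" "j < n" by (auto simp: spectral_mat_def)
    have "(\<Sum>r<n. \<mu> r * v r i * v r j) = (\<Sum>r<n. (\<Sum>l<n. lap n E i l * v r l) * v r j)"
      using ij by (intro sum.cong refl) (simp flip: eig add: mv_def)
    also have "\<dots> = (\<Sum>r<n. \<Sum>l<n. lap n E i l * (v r l * v r j))"
      by (simp only: sum_distrib_right mult.assoc)
    also have "\<dots> = (\<Sum>l<n. \<Sum>r<n. lap n E i l * (v r l * v r j))" by (rule sum.swap)
    also have "\<dots> = (\<Sum>l<n. lap n E i l * of_bool (l = j))"
      using ij by (intro sum.cong refl) (simp add: compl flip: sum_distrib_left)
    also have "\<dots> = lap n E i j"
      using ij by (simp add: of_bool_def if_distrib[of "\<lambda>t. _ * t"] cong: if_cong)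
    finally show "laplacian n E $$ (i, j) = spectral_mat n v \<mu> $$ (i, j)"
      using ij by (simp add: spectral_mat_def)
  qed (auto simp: spectral_mat_def laplacian_def)
  have rayleigh: "ip n (v r) (mv n (lap n E) (v r)) = \<mu> r" if r: "r < n" for r
  proof -
    have "ip n (v r) (mv n (lap n E) (v r)) = ip n (v r) (\<lambda>i. \<mu> r * v r i)"
      by (rule ip_cong) (simp_all add: eig r)
    then show ?thesis using r by (simp add: ip_scale_right orth)
  qed
  have nonneg: "\<mu> r \<ge> 0" if "r < n" for r
    unfolding rayleigh[OF that, symmetric] laplacian_energy[OF graph]
    by (rule sum_nonneg) auto
  have centred: "(\<Sum>i<n. v r i) = 0" if "r < n" "\<mu> r \<noteq> 0" for r
  proof -
    have "\<mu> r * (\<Sum>i<n. v r i) = (\<Sum>i<n. mv n (lap n E) (v r) i)"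
      using that by (simp add: eig sum_distrib_left)
    also have "\<dots> = 0" by (rule sum_mv_lap[OF graph])
    finally show ?thesis using that by simp
  qed
  have le_max: "\<mu> r \<le> lambda_max (laplacian n E)" if r: "r < n" for r
  proof -
    have Lv: "laplacian n E *\<^sub>v vec n (v r) = \<mu> r \<cdot>\<^sub>v vec n (v r)"
    proof (rule eq_vecI)
      fix i assume "i < dim_vec (\<mu> r \<cdot>\<^sub>v vec n (v r))"
      then have i: "i < n" by simp
      have "(laplacian n E *\<^sub>v vec n (v r)) $ i = mv n (lap n E) (v r) i"
        using i laplacian_carrier[OF graph]
        by (auto simp: mv_def scalar_prod_def lessThan_atLeast0 intro!: sum.cong)
      then show "(laplacian n E *\<^sub>v vec n (v r)) $ i = (\<mu> r \<cdot>\<^sub>v vec n (v r)) $ i"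
        using i r by (simp add: eig)
    qed (use laplacian_carrier[OF graph] in auto)
    have "vec n (v r) \<noteq> 0\<^sub>v n"
    proof
      assume 0: "vec n (v r) = 0\<^sub>v n"
      have "v r i = 0" if "i < n" for i using arg_cong[OF 0, of "\<lambda>u. u $ i"] that by simp
      then have "ip n (v r) (v r) = 0" by (simp add: ip_self_eq_0)
      then show False using orth[OF r r] by simp
    qed
    then have "eigenvalue (laplacian n E) (\<mu> r)"
      using Lv laplacian_carrier[OF graph] unfolding eigenvalue_def eigenvector_def
      by (intro exI[of _ "vec n (v r)"]) auto
    \<comment> \<open>\<open>lambda_max\<close> is a \<open>Max\<close>, which bounds the members of
      a set only when the set is finite.\<close>
    moreover have "finite {m. eigenvalue (laplacian n E) m}"
      using card_finite_spectrum(1)[OF laplacian_carrier[OF graph]] by (simp add: spectrum_def)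
    ultimately show ?thesis unfolding lambda_max_def by (intro Max_ge) auto
  qed
  have trace: "(\<Sum>r<n. \<mu> r) = (\<Sum>i<n. lap n E i i)"
  proof -
    have "(\<Sum>i<n. lap n E i i) = (\<Sum>i<n. \<Sum>r<n. \<mu> r * (v r i * v r i))"
      unfolding L by (intro sum.cong refl) (simp add: spectral_mat_def mult_ac)
    also have "\<dots> = (\<Sum>r<n. \<Sum>i<n. \<mu> r * (v r i * v r i))" by (rule sum.swap)
    also have "\<dots> = (\<Sum>r<n. \<mu> r)"
      by (intro sum.cong refl) (simp add: orth[unfolded ip_def] flip: sum_distrib_left)
    finally show ?thesis by simp
  qed
  have res: "eff_res n E i j = (\<Sum>r<n. inverse (\<mu> r) * (v r i - v r j)\<^sup>2)" if ij: "i < n" "j < n" for i j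
  proof -
    define X where "X = spectral_mat n v (\<lambda>r. inverse (\<mu> r))"
    have X: "X \<in> carrier_mat n n" by (simp add: X_def spectral_mat_carrier)
    have pinv: "pinv (laplacian n E) = X" unfolding L X_def by (rule pinv_spectral_mat[OF orth])
    have X_unit: "X *\<^sub>v unit_vec n l = col X l" if "l < n" for l
      using X that by (intro eq_vecI) auto
    have Xd: "X *\<^sub>v (unit_vec n i - unit_vec n j) = col X i - col X j"
      using X ij by (subst mult_minus_distrib_mat_vec[of _ n n]) (auto simp: X_unit)
    have "eff_res n E i j = (unit_vec n i - unit_vec n j) \<bullet> (col X i - col X j)"
      unfolding eff_res_def Let_def pinv Xd ..
    also have "\<dots> = (X $$ (i, i) - X $$ (i, j)) - (X $$ (j, i) - X $$ (j, j))"
      using X ij by (subst minus_scalar_prod_distrib[of _ n]) auto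
    also have "\<dots> = (\<Sum>r<n. inverse (\<mu> r) * (v r i - v r j)\<^sup>2)"
      using ij by (simp add: X_def spectral_mat_def power2_eq_square algebra_simps flip: sum_subtractf sum.distrib)
    finally show ?thesis .
  qed
  have "(\<Sum>(i, j) \<in> {(i, j). i < j \<and> j < n}. eff_res n E i j)
      = (\<Sum>p \<in> {(i, j). i < j \<and> j < n}. \<Sum>r<n. inverse (\<mu> r) * (v r (fst p) - v r (snd p))\<^sup>2)"
    by (intro sum.cong refl) (auto simp: res)
  also have "\<dots> = (\<Sum>r<n. \<Sum>p \<in> {(i, j). i < j \<and> j < n}. inverse (\<mu> r) * (v r (fst p) - v r (snd p))\<^sup>2)"
    by (rule sum.swap)
  also have "\<dots> = (\<Sum>r<n. inverse (\<mu> r) * real n)"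
  proof (intro sum.cong refl)
    fix r assume "r \<in> {..<n}"
    then have r: "r < n" by simp
    \<comment> \<open>For a unit vector with zero sum the cross terms vanish, so the squared
      differences over ordered pairs add up to \<open>2 * n\<close>. A zero eigenvalue is handled by
      the factor \<open>inverse 0 = 0\<close>.\<close>
    have "(\<Sum>p \<in> {(i, j). i < j \<and> j < n}. (v r (fst p) - v r (snd p))\<^sup>2) = real n" if "\<mu> r \<noteq> 0"
    proof -
      have "2 * (\<Sum>(i, j) \<in> {(i, j). i < j \<and> j < n}. (v r i - v r j)\<^sup>2) = (\<Sum>i<n. \<Sum>j<n. (v r i - v r j)\<^sup>2)"
        by (rule sum_symmetric_eq_twice[symmetric]) (auto simp: power2_commute)
      also have "\<dots> = (\<Sum>i<n. real n * (v r i)\<^sup>2 + 1 - 2 * v r i * (\<Sum>j<n. v r j))"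
        using orth[OF r r]
        by (intro sum.cong refl) (simp add: power2_diff sum.distrib sum_subtractf sum_distrib_left ip_self mult_ac)
      also have "\<dots> = 2 * real n"
        using orth[OF r r] by (simp add: centred[OF r that] sum.distrib ip_self flip: sum_distrib_left)
      finally show ?thesis by (simp add: case_prod_unfold)
    qed
    then show "(\<Sum>p \<in> {(i, j). i < j \<and> j < n}. inverse (\<mu> r) * (v r (fst p) - v r (snd p))\<^sup>2) = inverse (\<mu> r) * real n"
      by (cases "\<mu> r = 0") (simp_all flip: sum_distrib_left)
  qed
  finally have total: "(\<Sum>(i, j) \<in> {(i, j). i < j \<and> j < n}. eff_res n E i j) = real n * (\<Sum>r<n. inverse (\<mu> r))"
    by (simp add: sum_distrib_right mult.commute flip: sum_distrib_left)
  have pairs: "real (n choose 2) = real n * (real n - 1) / 2"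
    using n by (simp add: choose_two real_of_nat_div of_nat_diff)
  have "omega_avg n E = 2 * (\<Sum>r<n. inverse (\<mu> r)) / (real n - 1)"
    unfolding omega_avg_def total pairs using n by (simp add: field_simps)
  with orth eig nonneg centred le_max trace show ?thesis by (rule that)
qed

section \<open>The sine distance\<close>

definition fsin :: "nat \<Rightarrow> (nat \<Rightarrow> real) \<Rightarrow> (nat \<Rightarrow> real) \<Rightarrow> real" where
  "fsin n x y = sqrt (1 - (ip n x y)\<^sup>2 / (ip n x x * ip n y y))"

lemma scalar_prod_eq_ip:
  assumes "dim_vec y = n"
  shows "x \<bullet> y = ip n (($) x) (($) y)"
  using assms by (simp add: scalar_prod_def ip_def lessThan_atLeast0)

lemma vsin_eq_fsin:
  assumes "dim_vec x = n" "dim_vec y = n"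
  shows "vsin x y = fsin n (($) x) (($) y)"
  by (simp add: vsin_def fsin_def scalar_prod_eq_ip[OF assms(1)] scalar_prod_eq_ip[OF assms(2)])

lemma fsin_commute: "fsin n x y = fsin n y x"
  by (simp add: fsin_def ip_commute mult.commute)

lemma fsin_bounds: "0 \<le> fsin n x y" "fsin n x y \<le> 1"
proof -
  have "(ip n x y)\<^sup>2 / (ip n x x * ip n y y) \<le> 1"
    using ip_Cauchy_Schwarz[of n x y] ip_self_nonneg[of n x] ip_self_nonneg[of n y]
    using mult_nonneg_nonneg[of "ip n x x" "ip n y y"] by (intro divide_le_eq_1[THEN iffD2]) linarith
  then show "0 \<le> fsin n x y" by (simp add: fsin_def)
  have "0 \<le> (ip n x y)\<^sup>2 / (ip n x x * ip n y y)"
    using ip_self_nonneg[of n x] ip_self_nonneg[of n y] by simp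
  then show "fsin n x y \<le> 1" by (simp add: fsin_def)
qed

definition nrm :: "nat \<Rightarrow> (nat \<Rightarrow> real) \<Rightarrow> real" where
  "nrm n x = sqrt (ip n x x)"

lemma nrm_eq_L2_set: "nrm n x = L2_set x {..<n}"
  by (simp add: nrm_def ip_self L2_set_def)

lemma nrm_triangle: "nrm n (\<lambda>i. x i + y i) \<le> nrm n x + nrm n y"
  by (simp add: nrm_eq_L2_set L2_set_triangle_ineq)

lemma nrm_nonneg: "0 \<le> nrm n x"
  by (simp add: nrm_eq_L2_set)

lemma nrm_scale: "nrm n (\<lambda>i. c * x i) = \<bar>c\<bar> * nrm n x"
  by (simp add: nrm_def ip_linear real_sqrt_mult flip: mult.assoc)

lemma nrm_power2: "(nrm n x)\<^sup>2 = ip n x x"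
  by (simp add: nrm_def ip_self_nonneg)

lemma ip_diff_scale:
  "ip n (\<lambda>i. x i - t * y i) (\<lambda>i. x i - t * y i) = ip n x x - 2 * t * ip n x y + t\<^sup>2 * ip n y y"
  by (simp add: ip_linear ip_commute[of n y x] power2_eq_square algebra_simps)

text \<open>The subtracted multiple of \<open>y\<close> is the orthogonal projection of
  \<open>x\<close> onto the line through \<open>y\<close>, so both sides are the distance from
  \<open>x\<close> to that line.\<close>

lemma nrm_mult_fsin:
  assumes "ip n x x \<noteq> 0" "ip n y y \<noteq> 0"
  shows "nrm n x * fsin n x y = nrm n (\<lambda>i. x i - ip n x y / ip n y y * y i)"
proof -
  have "ip n (\<lambda>i. x i - ip n x y / ip n y y * y i) (\<lambda>i. x i - ip n x y / ip n y y * y i)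
      = ip n x x * (1 - (ip n x y)\<^sup>2 / (ip n x x * ip n y y))"
    using assms unfolding ip_diff_scale by (simp add: field_simps power2_eq_square)
  then show ?thesis by (simp add: nrm_def fsin_def real_sqrt_mult)
qed

text \<open>By Pythagoras no multiple of \<open>y\<close> is closer to \<open>x\<close> than the
  projection. The free \<open>t\<close> allows a convenient competitor in the triangle
  inequality.\<close>

lemma nrm_mult_fsin_le:
  assumes x: "ip n x x \<noteq> 0" and y: "ip n y y \<noteq> 0"
  shows "nrm n x * fsin n x y \<le> nrm n (\<lambda>i. x i - t * y i)"
proof -
  have pos: "ip n y y > 0" using y ip_self_nonneg[of n y] by simp
  have "ip n (\<lambda>i. x i - t * y i) (\<lambda>i. x i - t * y i)
      = ip n (\<lambda>i. x i - ip n x y / ip n y y * y i) (\<lambda>i. x i - ip n x y / ip n y y * y i)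
        + ip n y y * (t - ip n x y / ip n y y)\<^sup>2"
    using y unfolding ip_diff_scale by (simp add: field_simps power2_eq_square)
  then have "ip n (\<lambda>i. x i - ip n x y / ip n y y * y i) (\<lambda>i. x i - ip n x y / ip n y y * y i)
      \<le> ip n (\<lambda>i. x i - t * y i) (\<lambda>i. x i - t * y i)"
    using pos by simp
  then show ?thesis unfolding nrm_mult_fsin[OF assms] unfolding nrm_def by (rule real_sqrt_le_mono)
qed

text \<open>Projecting \<open>a\<close> onto \<open>b\<close> and the result onto \<open>c\<close>
  yields a multiple of \<open>c\<close>, a competitor for the best approximation of
  \<open>a\<close>. The second error is scaled by \<open>s\<close>, and Cauchy-Schwarz bounds the
  length of \<open>s\<close> times \<open>b\<close> by that of \<open>a\<close>.\<close>

lemma fsin_triangle: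
  assumes a: "ip n a a \<noteq> 0" and b: "ip n b b \<noteq> 0" and c: "ip n c c \<noteq> 0"
  shows "fsin n a c \<le> fsin n a b + fsin n b c"
proof -
  define s where "s = ip n a b / ip n b b"
  define t where "t = ip n b c / ip n c c"
  have pos: "nrm n a > 0" "nrm n b > 0"
    using a b ip_self_nonneg[of n a] ip_self_nonneg[of n b] by (auto simp: nrm_def)
  have "\<bar>ip n a b\<bar> \<le> nrm n a * nrm n b"
    using ip_Cauchy_Schwarz[of n a b] by (simp add: nrm_def real_le_rsqrt flip: real_sqrt_mult real_sqrt_abs)
  then have s: "\<bar>s\<bar> * nrm n b \<le> nrm n a"
    using pos unfolding s_def nrm_power2[symmetric] by (simp add: field_simps power2_eq_square)
  have "nrm n a * fsin n a c \<le> nrm n (\<lambda>i. a i - (s * t) * c i)"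
    by (rule nrm_mult_fsin_le[OF a c])
  also have "\<dots> = nrm n (\<lambda>i. (a i - s * b i) + s * (b i - t * c i))"
    by (simp add: algebra_simps)
  also have "\<dots> \<le> nrm n (\<lambda>i. a i - s * b i) + nrm n (\<lambda>i. s * (b i - t * c i))"
    by (rule nrm_triangle)
  also have "nrm n (\<lambda>i. s * (b i - t * c i)) = \<bar>s\<bar> * nrm n b * fsin n b c"
    using nrm_mult_fsin[OF b c] by (simp add: nrm_scale t_def mult.assoc)
  also have "nrm n (\<lambda>i. a i - s * b i) = nrm n a * fsin n a b"
    using nrm_mult_fsin[OF a b] by (simp add: s_def)
  also have "\<bar>s\<bar> * nrm n b * fsin n b c \<le> nrm n a * fsin n b c"
    using s fsin_bounds(1) by (rule mult_right_mono)
  finally have "nrm n a * fsin n a c \<le> nrm n a * (fsin n a b + fsin n b c)"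
    by (simp add: distrib_left)
  then show ?thesis using pos by simp
qed

text \<open>By convexity the graph of \<open>exp\<close> lies above its tangent at the smaller
  argument.\<close>

lemma exp_diff_ge: "exp (min a b) * \<bar>a - b\<bar> \<le> \<bar>exp a - exp (b::real)\<bar>"
proof -
  have *: "exp b * (a - b) \<le> exp a - exp b" if "b \<le> a" for a b :: real
  proof -
    have "exp b * (1 + (a - b)) \<le> exp b * exp (a - b)"
      by (intro mult_left_mono exp_ge_add_one_self) simp
    then show ?thesis by (simp add: algebra_simps flip: exp_add)
  qed
  show ?thesis using *[of a b] *[of b a] by (cases "b \<le> a") (auto simp: min_def abs_if)
qed

text \<open>The best multiple of \<open>exp \<circ> \<phi>\<close> is \<open>exp (\<phi> + s)\<close> with \<open>s\<close> bounded, and a shift by the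
constant \<open>s\<close> cannot bring the centred vectors \<open>\<theta>\<close> and \<open>\<phi>\<close> closer to each other.\<close>
lemma fsin_exp_ge:
  assumes n: "n > 0"
    and \<theta>: "\<And>i. i < n \<Longrightarrow> \<bar>\<theta> i\<bar> \<le> 1" and \<phi>: "\<And>i. i < n \<Longrightarrow> \<bar>\<phi> i\<bar> \<le> 1"
    and sum\<theta>: "(\<Sum>i<n. \<theta> i) = 0" and sum\<phi>: "(\<Sum>i<n. \<phi> i) = 0"
  shows "exp (-4) * nrm n (\<lambda>i. \<theta> i - \<phi> i) / sqrt n \<le> fsin n (\<lambda>i. exp (\<theta> i)) (\<lambda>i. exp (\<phi> i))"
proof -
  define x where "x = (\<lambda>i. exp (\<theta> i))"
  define y where "y = (\<lambda>i. exp (\<phi> i))"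
  have xpos: "ip n x x > 0" and ypos: "ip n y y > 0"
    using n by (auto simp: ip_def x_def y_def intro!: sum_pos)
  define t where "t = ip n x y / ip n y y"
  \<comment> \<open>The exponents differ by at most 2, so the vectors are comparable entrywise and
    the projection coefficient \<open>t\<close> is at least \<open>exp (-2)\<close>.\<close>
  have bounds: "exp (-2) * y i \<le> x i" "x i \<le> exp 2 * y i" if "i < n" for i
    using \<theta>[OF that] \<phi>[OF that] by (auto simp: x_def y_def abs_le_iff simp flip: exp_add)
  have "exp (-2) * ip n y y \<le> ip n x y"
    unfolding ip_def sum_distrib_left mult.assoc[symmetric]
    by (intro sum_mono mult_right_mono bounds) (auto simp: y_def)
  then have t1: "exp (-2) \<le> t" using ypos by (simp add: t_def field_simps)
  have "ip n x y \<le> exp 2 * ip n y y"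
    unfolding ip_def sum_distrib_left mult.assoc[symmetric]
    by (intro sum_mono mult_right_mono bounds) (auto simp: y_def)
  have tpos: "t > 0" using t1 by (rule less_le_trans[OF exp_gt_zero])
  define s where "s = ln t"
  have es: "exp s = t" using tpos by (simp add: s_def)
  have s: "-2 \<le> s" using t1 tpos by (simp add: s_def ln_ge_iff)
  have "(exp (-3))\<^sup>2 * ip n (\<lambda>i. \<theta> i - \<phi> i) (\<lambda>i. \<theta> i - \<phi> i)
      \<le> (exp (-3))\<^sup>2 * ip n (\<lambda>i. (\<theta> i - \<phi> i) - s) (\<lambda>i. (\<theta> i - \<phi> i) - s)"
  proof (rule mult_left_mono)
    have "ip n (\<lambda>i. \<theta> i - \<phi> i - s) (\<lambda>i. \<theta> i - \<phi> i - s)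
       = ip n (\<lambda>i. \<theta> i - \<phi> i) (\<lambda>i. \<theta> i - \<phi> i) - 2 * s * ((\<Sum>i<n. \<theta> i) - (\<Sum>i<n. \<phi> i)) + real n * s\<^sup>2"
      by (simp add: ip_def power2_eq_square algebra_simps sum.distrib sum_subtractf sum_distrib_left)
    then show "ip n (\<lambda>i. \<theta> i - \<phi> i) (\<lambda>i. \<theta> i - \<phi> i) \<le> ip n (\<lambda>i. \<theta> i - \<phi> i - s) (\<lambda>i. \<theta> i - \<phi> i - s)"
      using sum\<theta> sum\<phi> by simp
  qed simp
  also have "\<dots> = (\<Sum>i<n. (exp (-3) * \<bar>\<theta> i - \<phi> i - s\<bar>)\<^sup>2)"
    by (simp add: ip_self sum_distrib_left power_mult_distrib)
  also have "\<dots> \<le> (\<Sum>i<n. \<bar>x i - t * y i\<bar>\<^sup>2)"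
  proof (intro sum_mono power_mono)
    fix i assume "i \<in> {..<n}"
    then have i: "i < n" by simp
    \<comment> \<open>\<open>\<theta> i\<close> and \<open>\<phi> i\<close> are at least -1 and
      \<open>s\<close> is at least -2; this is the source of \<open>exp (-3)\<close>.\<close>
    have "- 3 \<le> min (\<theta> i) (\<phi> i + s)" using \<theta>[OF i] \<phi>[OF i] s by (auto simp: abs_le_iff)
    then have "exp (-3) * \<bar>\<theta> i - (\<phi> i + s)\<bar> \<le> exp (min (\<theta> i) (\<phi> i + s)) * \<bar>\<theta> i - (\<phi> i + s)\<bar>"
      by (intro mult_right_mono) auto
    also have "\<dots> \<le> \<bar>exp (\<theta> i) - exp (\<phi> i + s)\<bar>" by (rule exp_diff_ge)
    also have "exp (\<phi> i + s) = t * y i" by (simp add: exp_add es y_def)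
    finally show "exp (-3) * \<bar>\<theta> i - \<phi> i - s\<bar> \<le> \<bar>x i - t * y i\<bar>"
      by (simp add: x_def diff_diff_eq)
  qed auto
  also have "\<dots> = (nrm n x * fsin n x y)\<^sup>2"
    using nrm_mult_fsin[of n x y] xpos ypos by (simp add: t_def nrm_power2 ip_self)
  finally have "(exp (-3) * nrm n (\<lambda>i. \<theta> i - \<phi> i))\<^sup>2 \<le> (nrm n x * fsin n x y)\<^sup>2"
    by (simp add: nrm_power2 power_mult_distrib)
  then have "exp (-3) * nrm n (\<lambda>i. \<theta> i - \<phi> i) \<le> nrm n x * fsin n x y"
    by (rule power2_le_imp_le) (intro mult_nonneg_nonneg nrm_nonneg fsin_bounds)
  also have "\<dots> \<le> (exp 1 * sqrt n) * fsin n x y"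
  proof (intro mult_right_mono fsin_bounds)
    \<comment> \<open>The norm of \<open>x\<close> is at most \<open>exp 1 * sqrt n\<close>;
      dividing by it turns \<open>exp (-3)\<close> into \<open>exp (-4)\<close>.\<close>
    have "ip n x x \<le> (\<Sum>i<n. (exp 1)\<^sup>2)"
      unfolding ip_self using \<theta> by (intro sum_mono power_mono) (auto simp: x_def abs_le_iff)
    then have "nrm n x \<le> sqrt ((exp 1)\<^sup>2 * n)" unfolding nrm_def by (intro real_sqrt_le_mono) (simp add: mult.commute)
    then show "nrm n x \<le> exp 1 * sqrt n" by (simp add: real_sqrt_mult)
  qed
  finally have "exp (-1) * (exp (-3) * nrm n (\<lambda>i. \<theta> i - \<phi> i)) \<le> exp (-1) * ((exp 1 * sqrt n) * fsin n x y)"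
    by (intro mult_left_mono) auto
  then have "exp (-4) * nrm n (\<lambda>i. \<theta> i - \<phi> i) \<le> sqrt n * fsin n x y"
    by (simp flip: exp_add mult.assoc)
  then show ?thesis using n unfolding x_def y_def by (simp add: field_simps)
qed

section \<open>Overlap of the outcome distributions\<close>

text \<open>The logarithms of both sides agree at 0, and for nonnegative arguments their derivatives
  compare because tanh t is at most t. Evenness covers the negative arguments.\<close>

lemma cosh_le_exp_square: "cosh x \<le> exp (x\<^sup>2 / 2)" for x :: real
proof -
  have *: "cosh x \<le> exp (x\<^sup>2 / 2)" if x: "x \<ge> 0" for x :: real
  proof -
    have sinh_le: "sinh t \<le> t * cosh t" if "t \<ge> 0" for t :: real
    proof -
      have "0 * cosh 0 - sinh 0 \<le> t * cosh t - sinh t"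
        by (rule DERIV_nonneg_imp_nondecreasing[OF that])
          (auto intro!: exI derivative_eq_intros)
      then show ?thesis by simp
    qed
    have "0\<^sup>2 / 2 - ln (cosh 0) \<le> x\<^sup>2 / 2 - ln (cosh x)"
    proof (rule DERIV_nonneg_imp_nondecreasing[OF x])
      fix t :: real assume "0 \<le> t"
      then have "t - sinh t / cosh t \<ge> 0" using sinh_le[of t] by (simp add: divide_le_eq)
      moreover have "((\<lambda>x. x\<^sup>2 / 2 - ln (cosh x)) has_real_derivative t - sinh t / cosh t) (at t)"
        by (auto intro!: derivative_eq_intros)
      ultimately show "\<exists>y. ((\<lambda>x. x\<^sup>2 / 2 - ln (cosh x)) has_real_derivative y) (at t) \<and> 0 \<le> y" by blast
    qed
    then have "ln (cosh x) \<le> x\<^sup>2 / 2" by simp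
    then have "exp (ln (cosh x)) \<le> exp (x\<^sup>2 / 2)" by (simp only: exp_le_cancel_iff)
    then show ?thesis by (simp add: cosh_real_pos)
  qed
  show ?thesis using *[of x] *[of "-x"] by (cases "x \<ge> 0") auto
qed

text \<open>The usual exp x / (1 + exp x), and its complement, with numerator and denominator
  multiplied by exp (-x/2). This form makes the two outcomes mirror images.\<close>

definition logistic :: "real \<Rightarrow> bool \<Rightarrow> real" where
  "logistic x b = (if b then exp (x / 2) else exp (- x / 2)) / (2 * cosh (x / 2))"

text \<open>In the coordinates \<open>u\<close> and \<open>v\<close> the affinity is cosh u divided
  by the root of cosh (u + v) cosh (u - v). That product is at most (cosh u cosh v)^2, which leaves
  1 / cosh v; \<open>cosh_le_exp_square\<close> then gives the exponent, as v^2 / 2 = (x - y)^2 /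
  32.\<close>

lemma logistic_affinity:
  "exp (- (x - y)\<^sup>2 / 32) \<le> sqrt (logistic x True * logistic y True) + sqrt (logistic x False * logistic y False)"
proof -
  define u where "u = (x + y) / 4"
  define v where "v = (x - y) / 4"
  have xy: "x / 2 = u + v" "y / 2 = u - v" by (auto simp: u_def v_def field_simps)
  define c where "c = cosh (u + v) * cosh (u - v)"
  have c0: "c > 0" by (simp add: c_def cosh_real_pos)
  have "c = (cosh u * cosh v)\<^sup>2 - (sinh u * sinh v)\<^sup>2"
    by (simp add: c_def cosh_add cosh_diff power2_eq_square algebra_simps)
  then have "sqrt c \<le> sqrt ((cosh u * cosh v)\<^sup>2)" by (intro real_sqrt_le_mono) simp
  then have c: "sqrt c \<le> cosh u * cosh v" by (simp add: cosh_real_nonneg abs_mult)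
  have sqrt_exp: "sqrt (exp (2 * t)) = exp t" for t :: real
    by (rule real_sqrt_unique) (simp_all flip: exp_double)
  have "logistic x True * logistic y True = exp (2 * u) / (2\<^sup>2 * c)"
    unfolding logistic_def xy c_def by (simp add: power2_eq_square flip: exp_add)
  then have T: "sqrt (logistic x True * logistic y True) = exp u / (2 * sqrt c)"
    by (simp add: real_sqrt_divide real_sqrt_mult sqrt_exp)
  have "logistic x False * logistic y False = exp (2 * - u) / (2\<^sup>2 * c)"
    unfolding logistic_def minus_divide_left[symmetric] xy c_def by (simp add: power2_eq_square flip: exp_add)
  then have F: "sqrt (logistic x False * logistic y False) = exp (- u) / (2 * sqrt c)"
    by (simp only: real_sqrt_divide real_sqrt_mult sqrt_exp) simp
  have "exp (- (x - y)\<^sup>2 / 32) = 1 / exp (v\<^sup>2 / 2)"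
    by (simp add: v_def exp_minus field_simps)
  also have "\<dots> \<le> 1 / cosh v"
    using cosh_le_exp_square[of v] by (intro divide_left_mono) (auto simp: cosh_real_pos)
  also have "\<dots> = cosh u / (cosh u * cosh v)" by simp
  also have "\<dots> \<le> cosh u / sqrt c"
    using c c0 by (intro divide_left_mono) (auto simp: cosh_real_pos cosh_real_nonneg)
  also have "\<dots> = exp u / (2 * sqrt c) + exp (- u) / (2 * sqrt c)"
    by (simp add: cosh_field_def add_divide_distrib)
  finally show ?thesis unfolding T F .
qed

text \<open>Boolean functions supported in \<open>A\<close> correspond to subsets of
  \<open>A\<close>, which index the terms of the expanded product. Normalisation of the outcome law
  and multiplicativity of the affinity are both instances.\<close>

lemma sum_prod_bool_functions:
  fixes f :: "'a \<Rightarrow> bool \<Rightarrow> 'b :: comm_semiring_1"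
  assumes A: "finite A"
  shows "(\<Sum>y \<in> {y. \<forall>s. s \<notin> A \<longrightarrow> \<not> y s}. \<Prod>s\<in>A. f s (y s)) = (\<Prod>s\<in>A. f s True + f s False)"
proof -
  have "(\<Prod>s\<in>A. f s True + f s False) = (\<Sum>X\<in>Pow A. (\<Prod>s\<in>X. f s True) * (\<Prod>s\<in>A - X. f s False))"
    by (rule prod_add[OF A])
  also have "\<dots> = (\<Sum>X\<in>Pow A. \<Prod>s\<in>A. f s (s \<in> X))"
  proof (intro sum.cong refl)
    fix X assume "X \<in> Pow A"
    then have "(\<Prod>s\<in>A. f s (s \<in> X)) = (\<Prod>s\<in>A - X. f s (s \<in> X)) * (\<Prod>s\<in>X. f s (s \<in> X))"
      using A by (intro prod.subset_diff) auto
    then show "(\<Prod>s\<in>X. f s True) * (\<Prod>s\<in>A - X. f s False) = (\<Prod>s\<in>A. f s (s \<in> X))"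
      by (simp add: mult.commute)
  qed
  also have "\<dots> = (\<Sum>y \<in> {y. \<forall>s. s \<notin> A \<longrightarrow> \<not> y s}. \<Prod>s\<in>A. f s (y s))"
    by (rule sum.reindex_bij_witness[of _ Collect "\<lambda>X s. s \<in> X"]) auto
  finally show ?thesis by simp
qed

section \<open>Outcome laws as products over comparison slots\<close>

lemma finite_slots: "finite (slots n E k)"
  by (rule finite_subset[of _ "{..<n} \<times> {..<n} \<times> {..<k}"]) (auto simp: slots_def)

definition slot_prob :: "real vec \<Rightarrow> nat \<times> nat \<times> nat \<Rightarrow> bool \<Rightarrow> real" where
  "slot_prob w s b = (case s of (i, j, l) \<Rightarrow>
      if b then w $ i / (w $ i + w $ j) else w $ j / (w $ i + w $ j))"

lemma btl_prob_eq: "btl_prob n E k w y = (\<Prod>s\<in>slots n E k. slot_prob w s (y s))"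
  unfolding btl_prob_def slot_prob_def by (rule prod.cong) auto

lemma slot_prob_nonneg:
  assumes "w \<in> pos_weights n" "s \<in> slots n E k"
  shows "0 \<le> slot_prob w s b"
proof -
  obtain i j l where s: "s = (i, j, l)" by (cases s)
  then have "w $ i > 0" "w $ j > 0" using assms by (auto simp: slots_def pos_weights_def)
  then show ?thesis by (simp add: slot_prob_def s)
qed

lemma slot_prob_sum:
  assumes "w \<in> pos_weights n" "s \<in> slots n E k"
  shows "slot_prob w s True + slot_prob w s False = 1"
proof -
  obtain i j l where s: "s = (i, j, l)" by (cases s)
  then have "w $ i > 0" "w $ j > 0" using assms by (auto simp: slots_def pos_weights_def)
  then show ?thesis by (simp add: slot_prob_def s flip: add_divide_distrib)
qed

lemma btl_prob_nonneg: "w \<in> pos_weights n \<Longrightarrow> 0 \<le> btl_prob n E k w y"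
  unfolding btl_prob_eq by (intro prod_nonneg slot_prob_nonneg)

lemma btl_prob_sum:
  assumes "w \<in> pos_weights n"
  shows "(\<Sum>y\<in>outcomes n E k. btl_prob n E k w y) = 1"
  unfolding btl_prob_eq outcomes_def sum_prod_bool_functions[OF finite_slots]
  by (rule prod.neutral) (simp add: slot_prob_sum[OF assms])

text \<open>The common factor \<open>exp ((\<theta> i + \<theta> j) / 2)\<close> cancels, so on the
  logarithmic scale only the difference of the parameters matters.\<close>

lemma slot_prob_exp:
  assumes "i < n" "j < n"
  shows "slot_prob (vec n (\<lambda>i. exp (\<theta> i))) (i, j, l) b = logistic (\<theta> i - \<theta> j) b"
proof -
  let ?m = "exp ((\<theta> i + \<theta> j) / 2)" and ?a = "(\<theta> i - \<theta> j) / 2"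
  have i: "exp (\<theta> i) = ?m * exp ?a" and j: "exp (\<theta> j) = ?m * exp (- ?a)"
    by (simp_all add: field_simps flip: exp_add)
  have "exp (\<theta> i) + exp (\<theta> j) = ?m * (2 * cosh ?a)"
    unfolding i j by (simp add: cosh_field_def algebra_simps)
  then show ?thesis
    using assms unfolding slot_prob_def logistic_def minus_divide_left[symmetric]
    by (simp add: i j del: exp_minus)
qed

lemma sum_slots:
  "(\<Sum>(i, j, l) \<in> slots n E k. g i j)
    = real k * (\<Sum>(i, j) \<in> {(i, j). i < j \<and> j < n}. of_bool (E i j) * g i j)"
proof -
  let ?U = "{(i, j). i < j \<and> j < n}"
  have fin: "finite ?U" by (rule finite_subset[of _ "{..<n} \<times> {..<n}"]) auto
  have "(\<Sum>(i, j, l) \<in> slots n E k. g i j)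
      = (\<Sum>(p, l) \<in> {p \<in> ?U. E (fst p) (snd p)} \<times> {..<k}. g (fst p) (snd p))"
    by (rule sum.reindex_bij_witness[of _ "\<lambda>((i, j), l). (i, j, l)" "\<lambda>(i, j, l). ((i, j), l)"])
      (auto simp: slots_def)
  also have "\<dots> = (\<Sum>p \<in> {p \<in> ?U. E (fst p) (snd p)}. real k * g (fst p) (snd p))"
    by (simp flip: sum.cartesian_product)
  also have "\<dots> = (\<Sum>p \<in> ?U. if E (fst p) (snd p) then real k * g (fst p) (snd p) else 0)"
    by (rule sum.inter_filter[OF fin])
  also have "\<dots> = real k * (\<Sum>p \<in> ?U. of_bool (E (fst p) (snd p)) * g (fst p) (snd p))"
    unfolding sum_distrib_left by (rule sum.cong) auto
  finally show ?thesis by (simp add: case_prod_unfold)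
qed

lemma exp_weights_pos: "vec n (\<lambda>i. exp (\<theta> i)) \<in> pos_weights n"
  by (simp add: pos_weights_def)

lemma sqrt_prod: "sqrt (\<Prod>s\<in>A. f s) = (\<Prod>s\<in>A. sqrt (f s))"
  by (induction A rule: infinite_finite_induct) (simp_all add: real_sqrt_mult)

text \<open>The Hellinger affinity of independent comparisons is the product of the slot affinities,
  each bounded by \<open>logistic_affinity\<close>. The exponents add up because every edge occurs
  in \<open>k\<close> slots.\<close>

lemma btl_affinity:
  "exp (- real k * (\<Sum>(i, j) \<in> {(i, j). i < j \<and> j < n}.
        of_bool (E i j) * ((\<theta> i - \<phi> i) - (\<theta> j - \<phi> j))\<^sup>2) / 32)
    \<le> (\<Sum>y\<in>outcomes n E k. sqrt (btl_prob n E k (vec n (\<lambda>i. exp (\<theta> i))) y * btl_prob n E k (vec n (\<lambda>i. exp (\<phi> i))) y))"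
proof -
  let ?w = "vec n (\<lambda>i. exp (\<theta> i))" and ?w' = "vec n (\<lambda>i. exp (\<phi> i))"
  define d where "d = (\<lambda>(i, j, l :: nat). ((\<theta> i - \<phi> i) - (\<theta> j - \<phi> j))\<^sup>2)"
  have "(\<Sum>s \<in> slots n E k. d s) = real k * (\<Sum>(i, j) \<in> {(i, j). i < j \<and> j < n}.
        of_bool (E i j) * ((\<theta> i - \<phi> i) - (\<theta> j - \<phi> j))\<^sup>2)"
    unfolding d_def by (rule sum_slots)
  then have "exp (- real k * (\<Sum>(i, j) \<in> {(i, j). i < j \<and> j < n}.
        of_bool (E i j) * ((\<theta> i - \<phi> i) - (\<theta> j - \<phi> j))\<^sup>2) / 32) = exp (\<Sum>s\<in>slots n E k. - d s / 32)"
    by (simp add: sum_negf flip: sum_divide_distrib)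
  also have "\<dots> = (\<Prod>s\<in>slots n E k. exp (- d s / 32))"
    by (rule exp_sum[OF finite_slots])
  also have "\<dots> \<le> (\<Prod>s\<in>slots n E k. sqrt (slot_prob ?w s True * slot_prob ?w' s True)
      + sqrt (slot_prob ?w s False * slot_prob ?w' s False))"
  proof (intro prod_mono conjI)
    fix s assume s: "s \<in> slots n E k"
    obtain i j l where ijl: "s = (i, j, l)" by (cases s)
    with s have ij: "i < n" "j < n" by (auto simp: slots_def)
    have "d s = ((\<theta> i - \<theta> j) - (\<phi> i - \<phi> j))\<^sup>2" by (simp add: d_def ijl algebra_simps)
    then show "exp (- d s / 32) \<le> sqrt (slot_prob ?w s True * slot_prob ?w' s True)
      + sqrt (slot_prob ?w s False * slot_prob ?w' s False)"
      using logistic_affinity[of "\<theta> i - \<theta> j" "\<phi> i - \<phi> j"] by (simp only: ijl slot_prob_exp[OF ij])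
  qed simp
  also have "\<dots> = (\<Sum>y\<in>outcomes n E k. \<Prod>s\<in>slots n E k. sqrt (slot_prob ?w s (y s) * slot_prob ?w' s (y s)))"
    unfolding outcomes_def by (rule sum_prod_bool_functions[OF finite_slots, symmetric])
  also have "\<dots> = (\<Sum>y\<in>outcomes n E k. sqrt (btl_prob n E k ?w y * btl_prob n E k ?w' y))"
    unfolding btl_prob_eq prod.distrib[symmetric] sqrt_prod ..
  finally show ?thesis .
qed

section \<open>From affinity to Assouad's lemma\<close>

lemma sum_min_ge_affinity:
  fixes P Q :: "'a \<Rightarrow> real"
  assumes P: "\<And>y. y \<in> Y \<Longrightarrow> 0 \<le> P y" "sum P Y = 1" and Q: "\<And>y. y \<in> Y \<Longrightarrow> 0 \<le> Q y" "sum Q Y = 1"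
  shows "(\<Sum>y\<in>Y. sqrt (P y * Q y))\<^sup>2 / 2 \<le> (\<Sum>y\<in>Y. min (P y) (Q y))"
proof -
  \<comment> \<open>Le Cam's inequality: pointwise the product of \<open>P\<close> and
    \<open>Q\<close> is that of their minimum and maximum, so Cauchy-Schwarz applies to the two
    roots; the maxima sum to at most 2.\<close>
  have "(\<Sum>y\<in>Y. sqrt (P y * Q y)) = (\<Sum>y\<in>Y. sqrt (min (P y) (Q y)) * sqrt (max (P y) (Q y)))"
    by (intro sum.cong refl) (auto simp: real_sqrt_mult min_def max_def)
  then have "(\<Sum>y\<in>Y. sqrt (P y * Q y))\<^sup>2
      \<le> (\<Sum>y\<in>Y. (sqrt (min (P y) (Q y)))\<^sup>2) * (\<Sum>y\<in>Y. (sqrt (max (P y) (Q y)))\<^sup>2)"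
    by (simp add: Cauchy_Schwarz_ineq_sum)
  also have "\<dots> = (\<Sum>y\<in>Y. min (P y) (Q y)) * (\<Sum>y\<in>Y. max (P y) (Q y))"
    using P(1) Q(1) by (intro arg_cong2[of _ _ _ _ "(*)"] sum.cong refl) (auto simp: le_max_iff_disj)
  also have "\<dots> \<le> (\<Sum>y\<in>Y. min (P y) (Q y)) * 2"
  proof (rule mult_left_mono)
    have "(\<Sum>y\<in>Y. max (P y) (Q y)) \<le> (\<Sum>y\<in>Y. P y + Q y)"
      using P(1) Q(1) by (intro sum_mono) (auto simp: max_def)
    then show "(\<Sum>y\<in>Y. max (P y) (Q y)) \<le> 2" using P(2) Q(2) by (simp add: sum.distrib)
    show "0 \<le> (\<Sum>y\<in>Y. min (P y) (Q y))" using P(1) Q(1) by (intro sum_nonneg) auto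
  qed
  finally show ?thesis by simp
qed

text \<open>Splits the hypercube of sign patterns into its edges in direction
  \<open>r\<close>.\<close>

lemma sum_Pow_split:
  fixes f :: "'a set \<Rightarrow> real"
  assumes "finite I" "r \<in> I"
  shows "(\<Sum>S\<in>Pow I. f S) = (\<Sum>S\<in>Pow (I - {r}). f S + f (insert r S))"
proof -
  have "Pow I = Pow (I - {r}) \<union> insert r ` Pow (I - {r})"
    using Pow_insert[of r "I - {r}"] assms(2) by (simp add: insert_absorb)
  moreover have "Pow (I - {r}) \<inter> insert r ` Pow (I - {r}) = {}" by auto
  moreover have "inj_on (insert r) (Pow (I - {r}))"
    by (rule inj_onI) (metis Diff_insert_absorb PowD in_mono insertCI insert_Diff_if Diff_iff mk_disjoint_insert insertI1)
  ultimately show ?thesis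
    using assms(1) by (simp add: sum.union_disjoint sum.reindex sum.distrib)
qed

text \<open>The additive loss is treated one coordinate at a time. Along each edge in direction
  \<open>r\<close> the decision is wrong at exactly one end, which costs at least the overlap
  \<open>a\<close>; there are half as many edges as vertices, hence \<open>a / 2\<close>.\<close>

lemma assouad:
  fixes P :: "'i set \<Rightarrow> 'y \<Rightarrow> real"
  assumes I: "finite I"
    and P: "\<And>S y. S \<subseteq> I \<Longrightarrow> y \<in> Y \<Longrightarrow> 0 \<le> P S y"
    and c: "\<And>r. r \<in> I \<Longrightarrow> 0 \<le> c r"
    and overlap: "\<And>r S. r \<in> I \<Longrightarrow> S \<subseteq> I - {r} \<Longrightarrow> a \<le> (\<Sum>y\<in>Y. min (P S y) (P (insert r S) y))"
  shows "2 ^ card I * (a / 2 * (\<Sum>r\<in>I. c r))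
    \<le> (\<Sum>S\<in>Pow I. \<Sum>y\<in>Y. P S y * (\<Sum>r\<in>I. c r * of_bool ((r \<in> T y) \<noteq> (r \<in> S))))"
proof -
  have *: "2 ^ card I * (a / 2) \<le> (\<Sum>S\<in>Pow I. \<Sum>y\<in>Y. P S y * of_bool ((r \<in> T y) \<noteq> (r \<in> S)))" if r: "r \<in> I" for r
  proof -
    have "card I = Suc (card (I - {r}))" using I r by (metis card.remove)
    then have "2 ^ card I * (a / 2) = (\<Sum>S\<in>Pow (I - {r}). a)"
      using I by (simp add: card_Pow)
    also have "\<dots> \<le> (\<Sum>S\<in>Pow (I - {r}). (\<Sum>y\<in>Y. P S y * of_bool ((r \<in> T y) \<noteq> (r \<in> S)))
        + (\<Sum>y\<in>Y. P (insert r S) y * of_bool ((r \<in> T y) \<noteq> (r \<in> insert r S))))"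
    proof (rule sum_mono)
      fix S assume S: "S \<in> Pow (I - {r})"
      have "a \<le> (\<Sum>y\<in>Y. min (P S y) (P (insert r S) y))" using overlap[OF r] S by simp
      \<comment> \<open>Exactly one of the two indicators is 1, so the sum is one of the two
        probabilities and dominates their minimum.\<close>
      also have "\<dots> \<le> (\<Sum>y\<in>Y. P S y * of_bool ((r \<in> T y) \<noteq> (r \<in> S)) + P (insert r S) y * of_bool ((r \<in> T y) \<noteq> (r \<in> insert r S)))"
        using S by (intro sum_mono) auto
      finally show "a \<le> (\<Sum>y\<in>Y. P S y * of_bool ((r \<in> T y) \<noteq> (r \<in> S)))
        + (\<Sum>y\<in>Y. P (insert r S) y * of_bool ((r \<in> T y) \<noteq> (r \<in> insert r S)))"
        by (simp only: sum.distrib)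
    qed
    also have "\<dots> = (\<Sum>S\<in>Pow I. \<Sum>y\<in>Y. P S y * of_bool ((r \<in> T y) \<noteq> (r \<in> S)))"
      by (rule sum_Pow_split[OF I r, symmetric])
    finally show ?thesis .
  qed
  have "2 ^ card I * (a / 2 * (\<Sum>r\<in>I. c r)) = (\<Sum>r\<in>I. c r * (2 ^ card I * (a / 2)))"
    by (simp add: sum_distrib_left mult_ac)
  also have "\<dots> \<le> (\<Sum>r\<in>I. c r * (\<Sum>S\<in>Pow I. \<Sum>y\<in>Y. P S y * of_bool ((r \<in> T y) \<noteq> (r \<in> S))))"
    by (intro sum_mono mult_left_mono * c)
  also have "\<dots> = (\<Sum>r\<in>I. \<Sum>S\<in>Pow I. \<Sum>y\<in>Y. P S y * (c r * of_bool ((r \<in> T y) \<noteq> (r \<in> S))))"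
    unfolding sum_distrib_left by (simp only: mult.left_commute)
  also have "\<dots> = (\<Sum>S\<in>Pow I. \<Sum>r\<in>I. \<Sum>y\<in>Y. P S y * (c r * of_bool ((r \<in> T y) \<noteq> (r \<in> S))))"
    by (rule sum.swap)
  also have "\<dots> = (\<Sum>S\<in>Pow I. \<Sum>y\<in>Y. \<Sum>r\<in>I. P S y * (c r * of_bool ((r \<in> T y) \<noteq> (r \<in> S))))"
    by (rule sum.cong[OF refl], rule sum.swap)
  finally show ?thesis unfolding sum_distrib_left .
qed

section \<open>The minimax bound\<close>

lemma ip_combination:
  assumes orth: "\<And>r s. r \<in> I \<Longrightarrow> s \<in> I \<Longrightarrow> ip n (v r) (v s) = of_bool (r = s)" and I: "finite I"
  shows "ip n (\<lambda>i. \<Sum>r\<in>I. c r * v r i) (\<lambda>i. \<Sum>r\<in>I. d r * v r i) = (\<Sum>r\<in>I. c r * d r)"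
proof -
  have "ip n (\<lambda>i. \<Sum>r\<in>I. c r * v r i) (\<lambda>i. \<Sum>r\<in>I. d r * v r i)
      = (\<Sum>r\<in>I. \<Sum>s\<in>I. c r * d s * ip n (v r) (v s))"
    by (simp add: ip_sum_left ip_sum_right ip_linear sum_distrib_left mult_ac)
  also have "\<dots> = (\<Sum>r\<in>I. \<Sum>s\<in>I. if r = s then c r * d s else 0)"
    by (intro sum.cong refl) (simp add: orth)
  also have "\<dots> = (\<Sum>r\<in>I. c r * d r)" using I by simp
  finally show ?thesis .
qed

lemma mv_combination:
  assumes eig: "\<And>r. r \<in> I \<Longrightarrow> mv n A (v r) i = \<mu> r * v r i"
  shows "mv n A (\<lambda>i. \<Sum>r\<in>I. c r * v r i) i = (\<Sum>r\<in>I. (\<mu> r * c r) * v r i)"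
proof -
  have "mv n A (\<lambda>i. \<Sum>r\<in>I. c r * v r i) i = (\<Sum>j<n. \<Sum>r\<in>I. c r * (A i j * v r j))"
    by (simp add: mv_def sum_distrib_left mult_ac)
  also have "\<dots> = (\<Sum>r\<in>I. \<Sum>j<n. c r * (A i j * v r j))" by (rule sum.swap)
  also have "\<dots> = (\<Sum>r\<in>I. c r * mv n A (v r) i)" by (simp add: mv_def sum_distrib_left)
  also have "\<dots> = (\<Sum>r\<in>I. (\<mu> r * c r) * v r i)" by (rule sum.cong) (simp_all add: eig)
  finally show ?thesis .
qed

text \<open>A path from a vertex to any other vertex starts with an edge, so every degree is at
  least 1.\<close>

lemma laplacian_trace_ge:
  assumes graph: "simple_graph n E" and conn: "connected_graph n E" and n: "n \<ge> 2"
  shows "real n \<le> (\<Sum>i<n. lap n E i i)"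
proof -
  have "1 \<le> lap n E i i" if i: "i < n" for i
  proof -
    define j where "j = (if i = 0 then 1 else 0 :: nat)"
    have j: "j < n" "j \<noteq> i" using n by (auto simp: j_def)
    then have "(i, j) \<in> {(a, b). E a b}\<^sup>*" using conn i by (simp add: connected_graph_def)
    then obtain l where l: "E i l" using j(2) by (cases rule: converse_rtranclE) auto
    then have "l < n" using graph by (auto simp: simple_graph_def)
    then have "{l. l < n \<and> E i l} \<noteq> {}" using l by auto
    then have "1 \<le> card {l. l < n \<and> E i l}" by (simp add: Suc_le_eq card_gt_0_iff)
    then show ?thesis using i by (simp add: laplacian_def)
  qed
  then have "(\<Sum>i<n. 1) \<le> (\<Sum>i<n. lap n E i i)" by (intro sum_mono) auto
  then show ?thesis by simp
qed

text \<open>On the reals a supremum bounds the members of a set only if the set is bounded above;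
  here 1 is a bound since the sine never exceeds 1.\<close>

lemma bdd_above_btl_expect_vsin:
  assumes W: "\<And>y. y \<in> outcomes n E k \<Longrightarrow> dim_vec (W y) = n"
  shows "bdd_above ((\<lambda>w. btl_expect n E k w (\<lambda>y. \<bar>vsin (W y) w\<bar>)) ` pos_weights n)"
proof (rule bdd_aboveI2)
  fix w assume w: "w \<in> pos_weights n"
  then have "dim_vec w = n" by (simp add: pos_weights_def)
  then have "\<bar>vsin (W y) w\<bar> \<le> 1" if "y \<in> outcomes n E k" for y
    using W[OF that] fsin_bounds by (simp add: vsin_eq_fsin)
  then have "btl_expect n E k w (\<lambda>y. \<bar>vsin (W y) w\<bar>) \<le> (\<Sum>y\<in>outcomes n E k. btl_prob n E k w y * 1)"
    unfolding btl_expect_def by (intro sum_mono mult_left_mono btl_prob_nonneg[OF w])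
  then show "btl_expect n E k w (\<lambda>y. \<bar>vsin (W y) w\<bar>) \<le> 1" by (simp add: btl_prob_sum[OF w])
qed

text \<open>Turns the additive loss of Assouad's lemma into the unsquared sine.\<close>
lemma le_sqrt_mult_sqrt:
  assumes "0 \<le> h" "h \<le> m"
  shows "h \<le> sqrt m * sqrt h"
proof -
  have "h = sqrt h * sqrt h" using assms by simp
  also have "\<dots> \<le> sqrt m * sqrt h" using assms by (intro mult_right_mono) auto
  finally show ?thesis .
qed

text \<open>Origin of the constant: \<open>exp (-4)\<close> from the sine separation,
  \<open>exp (-1/4) / 2\<close> from the overlap of neighbours, one factor 1/2 from Assouad's lemma
  and one from replacing \<open>n - 1\<close> by \<open>n / 2\<close> in the average
  resistance.\<close>

lemma btl_minimax_lower_bound: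
  fixes W :: "(nat \<times> nat \<times> nat \<Rightarrow> bool) \<Rightarrow> real vec"
  assumes n: "n \<ge> 2" and graph: "simple_graph n E" and conn: "connected_graph n E"
    and k: "real k \<ge> sqrt (lambda_max (laplacian n E)) * real n * omega_avg n E"
    and W: "\<And>y. y \<in> outcomes n E k \<Longrightarrow> dim_vec (W y) = n \<and> W y \<noteq> 0\<^sub>v n"
  shows "exp (-4) * exp (-1/4) / 8 * sqrt (omega_avg n E / real k)
    \<le> (SUP w \<in> pos_weights n. btl_expect n E k w (\<lambda>y. \<bar>vsin (W y) w\<bar>))" (is "_ \<le> ?sup")
proof -
  obtain v \<mu> where orth: "\<And>r s. r < n \<Longrightarrow> s < n \<Longrightarrow> ip n (v r) (v s) = of_bool (r = s)"
    and eig: "\<And>r i. r < n \<Longrightarrow> i < n \<Longrightarrow> mv n (lap n E) (v r) i = \<mu> r * v r i"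
    and nonneg: "\<And>r. r < n \<Longrightarrow> \<mu> r \<ge> 0"
    and centred: "\<And>r. r < n \<Longrightarrow> \<mu> r \<noteq> 0 \<Longrightarrow> (\<Sum>i<n. v r i) = 0"
    and le_max: "\<And>r. r < n \<Longrightarrow> \<mu> r \<le> lambda_max (laplacian n E)"
    and trace: "(\<Sum>r<n. \<mu> r) = (\<Sum>i<n. lap n E i i)"
    and omega: "omega_avg n E = 2 * (\<Sum>r<n. inverse (\<mu> r)) / (real n - 1)"
    by (rule laplacian_spectrum[OF graph n]) blast
  define I where "I = {r. r < n \<and> \<mu> r \<noteq> 0}"
  have I: "finite I" "\<And>r. r \<in> I \<Longrightarrow> r < n" "\<And>r. r \<in> I \<Longrightarrow> \<mu> r > 0"
    using nonneg by (auto simp: I_def less_le)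
  define m where "m = (\<Sum>r\<in>I. inverse (\<mu> r))"
  have m_eq: "(\<Sum>r<n. inverse (\<mu> r)) = m"
    unfolding m_def by (rule sum.mono_neutral_right) (auto simp: I_def)
  \<comment> \<open>The trace is at least \<open>n\<close>, so some eigenvalue is at least 1. This
    yields both \<open>m > 0\<close> and \<open>lambda_max (laplacian n E) \<ge> 1\<close>.\<close>
  have "\<exists>r<n. \<mu> r \<ge> 1"
  proof (rule ccontr)
    assume "\<not> (\<exists>r<n. \<mu> r \<ge> 1)"
    then have "(\<Sum>r<n. \<mu> r) < (\<Sum>r<n. 1)" using n by (intro sum_strict_mono) (auto simp: not_le lessThan_empty_iff)
    then show False using laplacian_trace_ge[OF graph conn n] trace by simp
  qed
  then obtain r0 where r0: "r0 < n" "\<mu> r0 \<ge> 1" by blast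
  then have "r0 \<in> I" by (simp add: I_def)
  then have m: "m > 0" unfolding m_def using I by (intro sum_pos) auto
  have lmax: "lambda_max (laplacian n E) \<ge> 1" using le_max[OF r0(1)] r0(2) by simp
  \<comment> \<open>\<open>n * omega_avg n E\<close> equals \<open>2 * n * m / (n - 1)\<close>; the
    leading 1 is then enlarged to the root of the largest eigenvalue.\<close>
  have "m \<le> 1 * (real n * omega_avg n E)"
    using n m unfolding omega m_eq by (simp add: field_simps)
  also have "\<dots> \<le> sqrt (lambda_max (laplacian n E)) * (real n * omega_avg n E)"
    using lmax n m unfolding omega m_eq by (intro mult_right_mono) auto
  also have "\<dots> \<le> k" using k by (simp add: mult.assoc)
  finally have mk: "m \<le> k" .
  then have kpos: "real k > 0" using m by simp
  define sg where "sg S r = (if r \<in> S then 1 else - 1 :: real)" for S :: "nat set" and r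
  define cf where "cf S r = sg S r / sqrt (k * \<mu> r)" for S r
  define \<theta> where "\<theta> S i = (\<Sum>r\<in>I. cf S r * v r i)" for S i
  define w where "w S = vec n (\<lambda>i. exp (\<theta> S i))" for S
  \<comment> \<open>A weighted Hamming distance, which up to the factor \<open>4 / k\<close> is the
    squared distance between the parameters.\<close>
  define H where "H S T = (\<Sum>r\<in>I. inverse (\<mu> r) * of_bool ((r \<in> S) \<noteq> (r \<in> T)))" for S T :: "nat set"
  have w_pos: "w S \<in> pos_weights n" for S unfolding w_def by (rule exp_weights_pos)
  have orthI: "ip n (v r) (v s) = of_bool (r = s)" if "r \<in> I" "s \<in> I" for r s
    using that I(2) orth by blast
  have comb: "ip n (\<lambda>i. \<Sum>r\<in>I. c r * v r i) (\<lambda>i. \<Sum>r\<in>I. d r * v r i) = (\<Sum>r\<in>I. c r * d r)" for c d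
    by (rule ip_combination) (simp_all add: orthI I(1))
  have \<theta>_diff: "\<theta> S i - \<theta> T i = (\<Sum>r\<in>I. (cf S r - cf T r) * v r i)" for S T i
    by (simp add: \<theta>_def left_diff_distrib sum_subtractf)
  have cf_sq: "cf S r * cf S r = inverse (\<mu> r) / k" if "r \<in> I" for S r
    using I(3)[OF that] kpos by (simp add: cf_def sg_def field_simps)
  have cf_diff_sq: "(cf S r - cf T r) * (cf S r - cf T r) = 4 / k * (inverse (\<mu> r) * of_bool ((r \<in> S) \<noteq> (r \<in> T)))"
    if "r \<in> I" for S T r
  proof -
    have "sg S r - sg T r = 2 * sg S r * of_bool ((r \<in> S) \<noteq> (r \<in> T))" by (simp add: sg_def)
    then have "cf S r - cf T r = 2 * cf S r * of_bool ((r \<in> S) \<noteq> (r \<in> T))"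
      by (simp add: cf_def flip: diff_divide_distrib)
    then have "(cf S r - cf T r) * (cf S r - cf T r) = 4 * (cf S r * cf S r) * of_bool ((r \<in> S) \<noteq> (r \<in> T))"
      by auto
    then show ?thesis by (simp add: cf_sq[OF that])
  qed
  have sum\<theta>: "(\<Sum>i<n. \<theta> S i) = 0" for S
  proof -
    have "(\<Sum>i<n. \<theta> S i) = (\<Sum>r\<in>I. cf S r * (\<Sum>i<n. v r i))"
      unfolding \<theta>_def sum_distrib_left by (rule sum.swap)
    also have "\<dots> = 0" by (rule sum.neutral) (use centred in \<open>auto simp: I_def\<close>)
    finally show ?thesis .
  qed
  have \<theta>_le: "\<bar>\<theta> S i\<bar> \<le> 1" if "i < n" for S i
  proof -
    \<comment> \<open>A coordinate is bounded by the Euclidean norm, whose square is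
      \<open>m / k\<close> by orthonormality.\<close>
    have "(\<theta> S i)\<^sup>2 \<le> ip n (\<theta> S) (\<theta> S)"
      unfolding ip_self using that by (intro member_le_sum) auto
    also have "\<dots> = (\<Sum>r\<in>I. inverse (\<mu> r) / k)"
      unfolding \<theta>_def comb by (rule sum.cong) (simp_all add: cf_sq)
    also have "\<dots> = m / k" by (simp add: m_def sum_divide_distrib)
    also have "\<dots> \<le> 1" using mk kpos by simp
    finally show ?thesis by (simp add: abs_square_le_1)
  qed
  have dist: "ip n (\<lambda>i. \<theta> S i - \<theta> T i) (\<lambda>i. \<theta> S i - \<theta> T i) = 4 / k * H S T" for S T
    unfolding \<theta>_diff comb H_def sum_distrib_left
    by (rule sum.cong) (simp_all add: cf_diff_sq)
  have H_bounds: "0 \<le> H S T" "H S T \<le> m" for S T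
    unfolding H_def m_def using I(3) by (auto intro!: sum_nonneg sum_mono simp: less_imp_le)
  have separation: "exp (-4) * (2 * H S T) / sqrt (n * k * m) \<le> fsin n (($) (w S)) (($) (w T))" for S T
  proof -
    \<comment> \<open>The parameter distance is of order \<open>sqrt (H S T)\<close>, while
      Assouad's lemma takes a loss linear in \<open>H\<close>. Since \<open>H S T \<le> m\<close>,
      the root is at least \<open>H S T / sqrt m\<close>.\<close>
    have "exp (-4) * (2 * H S T) / sqrt (n * k * m) \<le> exp (-4) * (2 * (sqrt m * sqrt (H S T))) / sqrt (n * k * m)"
      using H_bounds m kpos n by (intro divide_right_mono mult_left_mono le_sqrt_mult_sqrt) auto
    also have "\<dots> = exp (-4) * sqrt (4 / k * H S T) / sqrt n"
      using m kpos n by (simp add: real_sqrt_mult real_sqrt_divide field_simps)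
    also have "\<dots> = exp (-4) * nrm n (\<lambda>i. \<theta> S i - \<theta> T i) / sqrt n" by (simp add: nrm_def dist)
    also have "\<dots> \<le> fsin n (\<lambda>i. exp (\<theta> S i)) (\<lambda>i. exp (\<theta> T i))"
      using n by (intro fsin_exp_ge \<theta>_le sum\<theta>) auto
    also have "\<dots> = fsin n (($) (w S)) (($) (w T))"
      unfolding fsin_def by (intro arg_cong[where f = sqrt] arg_cong2[where f = "(-)"] arg_cong2[where f = "(/)"]
        arg_cong2[where f = "(*)"] arg_cong2[where f = "power"] ip_cong refl) (simp_all add: w_def)
    finally show ?thesis .
  qed
  have overlap: "exp (-1/4) / 2 \<le> (\<Sum>y\<in>outcomes n E k. min (btl_prob n E k (w S) y) (btl_prob n E k (w (insert r S)) y))"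
    if r: "r \<in> I" and S: "S \<subseteq> I - {r}" for r S
  proof -
    let ?d = "\<lambda>i. \<theta> S i - \<theta> (insert r S) i"
    define c where "c s = cf S s - cf (insert r S) s" for s
    \<comment> \<open>Only coordinate \<open>r\<close> changes, and the scaling by
      \<open>sqrt (k * \<mu> r)\<close> cancels the eigenvalue, so every direction has the same
      energy.\<close>
    have c: "c s * (\<mu> s * c s) = (if s = r then 4 / k else 0)" if "s \<in> I" for s
    proof -
      have "c s * (\<mu> s * c s) = \<mu> s * (c s * c s)" by simp
      also have "\<dots> = \<mu> s * (4 / k * (inverse (\<mu> s) * of_bool (s = r)))"
        using S unfolding c_def cf_diff_sq[OF that] by auto
      finally show ?thesis using I(3)[OF that] by auto
    qed
    have "ip n ?d (mv n (lap n E) ?d)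
        = ip n (\<lambda>i. \<Sum>s\<in>I. c s * v s i) (\<lambda>i. \<Sum>s\<in>I. (\<mu> s * c s) * v s i)"
      unfolding \<theta>_diff c_def[symmetric] by (intro ip_cong mv_combination) (use eig I(2) in auto)
    also have "\<dots> = 4 / k"
      unfolding comb using I(1) r by (simp add: c cong: sum.cong)
    finally have "(\<Sum>(i, j) \<in> {(i, j). i < j \<and> j < n}. of_bool (E i j) * (?d i - ?d j)\<^sup>2) = 4 / k"
      by (simp add: laplacian_energy[OF graph])
    \<comment> \<open>The exponent is \<open>k * (4 / k) / 32 = 1 / 8\<close>; squaring the affinity
      produces \<open>exp (-1/4)\<close>.\<close>
    then have "exp (- real k * (4 / k) / 32)
        \<le> (\<Sum>y\<in>outcomes n E k. sqrt (btl_prob n E k (w S) y * btl_prob n E k (w (insert r S)) y))"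
      using btl_affinity[where n = n and E = E and k = k and \<theta> = "\<theta> S" and \<phi> = "\<theta> (insert r S)"]
      unfolding w_def by (simp only:)
    then have "exp (-1/8) \<le> (\<Sum>y\<in>outcomes n E k. sqrt (btl_prob n E k (w S) y * btl_prob n E k (w (insert r S)) y))"
      using kpos by simp
    then have "(exp (-1/8))\<^sup>2 / 2
        \<le> (\<Sum>y\<in>outcomes n E k. sqrt (btl_prob n E k (w S) y * btl_prob n E k (w (insert r S)) y))\<^sup>2 / 2"
      by (intro divide_right_mono power_mono) auto
    also have "\<dots> \<le> (\<Sum>y\<in>outcomes n E k. min (btl_prob n E k (w S) y) (btl_prob n E k (w (insert r S)) y))"
      by (intro sum_min_ge_affinity btl_prob_nonneg btl_prob_sum w_pos)
    also have "(exp (-1/8))\<^sup>2 = exp (-1/4 :: real)" by (simp flip: exp_double)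
    finally show ?thesis .
  qed
  \<comment> \<open>The estimator is turned into a decision by choosing \<open>T\<close> with
    \<open>w T\<close> at least as close to \<open>W y\<close> as every hypothesis.\<close>
  have "\<exists>T. \<forall>S\<in>Pow I. fsin n (($) (W y)) (($) (w T)) \<le> fsin n (($) (W y)) (($) (w S))" for y
    using I(1) ex_min_if_finite[of "(\<lambda>S. fsin n (($) (W y)) (($) (w S))) ` Pow I"] by (auto simp: not_less)
  then obtain T where T: "\<And>y S. S \<subseteq> I \<Longrightarrow> fsin n (($) (W y)) (($) (w (T y))) \<le> fsin n (($) (W y)) (($) (w S))"
    by (metis PowI)
  have loss: "exp (-4) / sqrt (n * k * m) * H (T y) S \<le> \<bar>vsin (W y) (w S)\<bar>"
    if y: "y \<in> outcomes n E k" and S: "S \<subseteq> I" for y S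
  proof -
    have wne: "ip n (($) (w S)) (($) (w S)) \<noteq> 0" for S
      unfolding ip_self_eq_0 using n by (auto simp: w_def intro!: exI[of _ 0])
    have Wne: "ip n (($) (W y)) (($) (W y)) \<noteq> 0"
      unfolding ip_self_eq_0 using W[OF y] by auto
    \<comment> \<open>The triangle inequality through \<open>W y\<close> and the minimality of
      \<open>T y\<close> cost a factor 2, which cancels the 2 in the separation bound.\<close>
    have "exp (-4) * (2 * H (T y) S) / sqrt (n * k * m) \<le> fsin n (($) (w (T y))) (($) (w S))"
      by (rule separation)
    also have "\<dots> \<le> fsin n (($) (w (T y))) (($) (W y)) + fsin n (($) (W y)) (($) (w S))"
      by (rule fsin_triangle[OF wne Wne wne])
    also have "\<dots> \<le> 2 * fsin n (($) (W y)) (($) (w S))"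
      using T[OF S, of y] by (simp add: fsin_commute[of n _ "($) (W y)"])
    also have "fsin n (($) (W y)) (($) (w S)) = vsin (W y) (w S)"
      using W[OF y] by (simp add: vsin_eq_fsin w_def)
    finally have le: "exp (-4) * (2 * H (T y) S) / sqrt (n * k * m) \<le> 2 * vsin (W y) (w S)" .
    have half: "a / 2 \<le> b" if "a \<le> 2 * b" for a b :: real using that by simp
    have "exp (-4) / sqrt (n * k * m) * H (T y) S = exp (-4) * (2 * H (T y) S) / sqrt (n * k * m) / 2"
      by simp
    also have "\<dots> \<le> vsin (W y) (w S)" by (rule half[OF le])
    also have "\<dots> \<le> \<bar>vsin (W y) (w S)\<bar>" by (rule abs_ge_self)
    finally show ?thesis .
  qed
  have "2 ^ card I * (exp (-4) / sqrt (n * k * m) * (exp (-1/4) / 2 / 2 * m))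
      = exp (-4) / sqrt (n * k * m) * (2 ^ card I * (exp (-1/4) / 2 / 2 * m))" by simp
  also have "\<dots> \<le> exp (-4) / sqrt (n * k * m)
      * (\<Sum>S\<in>Pow I. \<Sum>y\<in>outcomes n E k. btl_prob n E k (w S) y * H (T y) S)"
    unfolding m_def H_def
    by (intro mult_left_mono assouad I(1) btl_prob_nonneg w_pos overlap)
      (use I(3) m[unfolded m_def] in \<open>auto simp: less_imp_le\<close>)
  also have "\<dots> = (\<Sum>S\<in>Pow I. \<Sum>y\<in>outcomes n E k. btl_prob n E k (w S) y * (exp (-4) / sqrt (n * k * m) * H (T y) S))"
    unfolding sum_distrib_left by (intro sum.cong refl) (simp only: mult.left_commute)
  also have "\<dots> \<le> (\<Sum>S\<in>Pow I. btl_expect n E k (w S) (\<lambda>y. \<bar>vsin (W y) (w S)\<bar>))"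
    unfolding btl_expect_def by (intro sum_mono mult_left_mono loss btl_prob_nonneg w_pos) auto
  \<comment> \<open>The supremum dominates the average risk over all sign patterns.\<close>
  also have "\<dots> \<le> (\<Sum>S\<in>Pow I. ?sup)"
  proof (rule sum_mono)
    fix S
    show "btl_expect n E k (w S) (\<lambda>y. \<bar>vsin (W y) (w S)\<bar>) \<le> ?sup"
      using bdd_above_btl_expect_vsin[of n E k W] W w_pos by (intro cSUP_upper) auto
  qed
  also have "\<dots> = 2 ^ card I * ?sup" using I(1) by (simp add: card_Pow)
  finally have sup: "exp (-4) / sqrt (n * k * m) * (exp (-1/4) / 2 / 2 * m) \<le> ?sup"
    by (rule mult_left_le_imp_le) simp
  \<comment> \<open>As \<open>n\<close> is at least 2, \<open>n - 1\<close> is at least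
    \<open>n / 2\<close>, which gives the factor 4.\<close>
  have "omega_avg n E / k \<le> 4 * m / (n * k)"
  proof -
    have "omega_avg n E \<le> 4 * m / n"
      using n m unfolding omega m_eq by (simp add: field_simps)
    then have "omega_avg n E / k \<le> 4 * m / n / k" using kpos by (intro divide_right_mono) auto
    then show ?thesis by simp
  qed
  then have "sqrt (omega_avg n E / k) \<le> sqrt (2\<^sup>2 * (m / (n * k)))" by (intro real_sqrt_le_mono) simp
  also have "\<dots> = 2 * sqrt (m / (n * k))"
    by (simp only: real_sqrt_mult[of "2\<^sup>2"] real_sqrt_abs abs_numeral)
  also have "sqrt (m / (n * k)) = m / sqrt (n * k * m)"
    using m n kpos by (simp add: real_sqrt_divide real_sqrt_mult field_simps)
  finally have "exp (-4) * exp (-1/4) / 8 * sqrt (omega_avg n E / real k)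
      \<le> exp (-4) * exp (-1/4) / 8 * (2 * (m / sqrt (n * k * m)))"
    by (intro mult_left_mono) auto
  also have "\<dots> = exp (-4) / sqrt (n * k * m) * (exp (-1/4) / 2 / 2 * m)" by (simp add: mult_ac)
  also note sup
  finally show ?thesis .
qed

theorem theorem2:
  shows "\<exists>c c'. c > 0 \<and> c' > 0 \<and>
    (\<forall>n E (k::nat) (W :: (nat \<times> nat \<times> nat \<Rightarrow> bool) \<Rightarrow> real vec).
       n \<ge> 2 \<and> simple_graph n E \<and> connected_graph n E \<and>
       real k \<ge> c * sqrt (lambda_max (laplacian n E)) * real n * omega_avg n E \<and>
       (\<forall>y \<in> outcomes n E k. dim_vec (W y) = n \<and> W y \<noteq> 0\<^sub>v n) \<longrightarrow>
       (SUP w \<in> pos_weights n. btl_expect n E k w (\<lambda>y. \<bar>vsin (W y) w\<bar>))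
         \<ge> c' * sqrt (omega_avg n E / real k))"
  \<comment> \<open>The choice \<open>c = 1\<close> suffices: the lower bound on \<open>k\<close>
    enters only through \<open>m \<le> k\<close>.\<close>
  by (intro exI[of _ 1] exI[of _ "exp (-4) * exp (-1/4) / 8"] conjI allI impI btl_minimax_lower_bound) auto

end
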